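(* Let $\Omega=\{x\in\mathbb{R}^n:\ell\le x\le u\}$ with $\ell_i<u_i$ for all $i$, and let $f:\mathbb{R}^n\to\mathbb{R}$ be twice continuously differentiable, with $\nabla f$ $L_g$-Lipschitz continuous on $\mathbb{R}^n$ and $f$ bounded from below by $f_{\mathrm{low}}$. Consider Algorithm 1 (defined in the context, with parameters $\theta\in(0,1]$, $\rho\in(0,1/2)$, $m\in\mathbb{N}$, $a_1\ge 1$, $a_2\in(0,1)$, $\lambda_{\max}^{\mathrm{spg}}\ge\lambda_{\min}^{\mathrm{spg}}>0$). Each iteration of Algorithm 1 requires at most $$(m+5)+\max\left\{\left|\log_2\left(\min\left\{\frac12,\frac{(1-\rho)a_2}{2L_ga_1^2}\right\}\right)\right|,\ \left|\log_2\left(\min\left\{1,\frac{(1-2\rho)\lambda_{\min}^{\mathrm{spg}}}{4L_g}\right\}\right)\right|\right\}$$ calls to the oracle, and Algorithm 1 needs no more than $\mathcal{O}(n\epsilon^{-2})$ calls to the oracle to find $x^k$ such that $\|\nabla_\Omega f(x^k)\|\le\epsilon$; that is, there is a constant $C$ depending only on the parameters $\theta,\rho,m,a_1,a_2,\lambda_{\min}^{\mathrm{spg}},\lambda_{\max}^{\mathrm{spg}}$, on $L_g$ and on $f(x^0)-f_{\mathrm{low}}$ (not on $n$ or $\epsilon$) such that for all $\epsilon\in(0,1]$ at most $Cn\epsilon^{-2}$ oracle calls are needed.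
   Context: An oracle call is an evaluation of $f$, of $\nabla f$, or of $\nabla^2f$ at a point. Notation. $\|\cdot\|$ is the Euclidean norm, $P_\Omega$ the Euclidean projection onto $\Omega$, $[n]=\{1,\dots,n\}$. For $x\in\Omega$: $\mathcal{A}_0(x)=\{j\in[n]:x_j=\ell_j\}$, $\mathcal{A}_1(x)=\{j\in[n]:x_j=u_j\}$, $\mathcal{I}(x)=[n]\setminus(\mathcal{A}_0(x)\cup\mathcal{A}_1(x))$. The face of $x$ is $\mathcal{F}(x)=\{z\in\Omega: z_i=\ell_i\text{ if }i\in\mathcal{A}_0(x),\ z_i=u_i\text{ if }i\in\mathcal{A}_1(x),\ \ell_i<z_i<u_i\text{ otherwise}\}$; $\overline{\mathcal{F}}(x)$ is its closure and $\partial\mathcal{F}(x)=\overline{\mathcal{F}}(x)\setminus\mathcal{F}(x)$ its (relative) boundary. The reduced gradient is $\nabla_\Omega f(x)=x-P_\Omega(x-\nabla f(x))$, and $\nabla_\Omega^I f(x)\in\mathbb{R}^n$ has $i$-th entry $[\nabla_\Omega f(x)]_i$ if $i\in\mathcal{I}(x)$ and $0$ otherwise. $Q(x)\in\mathbb{R}^{n\times|\mathcal{I}(x)|}$ has as columns the canonical vectors $e_i$, $i\in\mathcal{I}(x)$, in increasing order, and $f_x(y)=f(x+Q(x)y)$ for $y\in\mathbb{R}^{|\mathcal{I}(x)|}$, so $\nabla f_x(0)=Q(x)^T\nabla f(x)$ and $\nabla^2f_x(0)=Q(x)^T\nabla^2f(x)Q(x)$. Algorithm 1. Start from $x^0\in\Omega$,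 $k=0$. At iteration $k$: if $\|\nabla_\Omega f(x^k)\|\le\epsilon$, stop. If $\|\nabla_\Omega^I f(x^k)\|\ge\theta\|\nabla_\Omega f(x^k)\|$, compute $x^{k+1}$ by Algorithm 2; otherwise compute $x^{k+1}$ by Algorithm 3. Increase $k$ by one and repeat. Algorithm 2 (at $x^k$). Step 1: using MINRES compute an approximate solution $d_1^k\in\mathbb{R}^{|\mathcal{I}(x^k)|}$ of $\min_s\|\nabla^2f_{x^k}(0)s+\nabla f_{x^k}(0)\|_2^2$ (no accuracy is prescribed). Set $d_2^k=\beta_1d_1^k$ with $\beta_1=1$ if $\|d_1^k\|\le a_1\|\nabla f_{x^k}(0)\|$ and $\beta_1=a_1\|\nabla f_{x^k}(0)\|/\|d_1^k\|$ otherwise. Set $d^k=\beta_2d_2^k+(1-\beta_2)(-\nabla f_{x^k}(0))$ with $\beta_2=1$ if $\langle\nabla f_{x^k}(0),d_2^k\rangle\le-a_2\|\nabla f_{x^k}(0)\|^2$ and $\beta_2=(1-a_2)/\left(1+\langle\nabla f_{x^k}(0),d_2^k\rangle/\|\nabla f_{x^k}(0)\|^2\right)$ otherwise. Step 2.1: if $x^k+Q(x^k)d^k\in\mathcal{F}(x^k)$, set $\alpha_0=1$ and go to Step 3. Step 2.2: if $f(P_\Omega(x^k+Q(x^k)d^k))\le f_{x^k}(0)$, then using at most $m$ oracle calls find $x^{k+1}\in\partial\mathcal{F}(x^k)$ with $f(x^{k+1})\le f(P_\Omega(x^k+Q(x^k)d^k))$ and stop. Step 2.3: let $t_{\max}=\max\{t\in(0,1]:x^k+tQ(x^k)d^k\in\Omega\}$.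 If $f_{x^k}(t_{\max}d^k)\le f_{x^k}(0)$, using at most $m$ oracle calls find $x^{k+1}\in\partial\mathcal{F}(x^k)$ with $f(x^{k+1})\le f_{x^k}(t_{\max}d^k)$ and stop; otherwise set $\alpha_0=t_{\max}$. Step 3: find the smallest nonnegative integer $\ell_k$ such that $f_{x^k}((0.5)^{\ell_k}\alpha_0d^k)\le f_{x^k}(0)+\rho(0.5)^{\ell_k}\alpha_0\langle\nabla f_{x^k}(0),d^k\rangle$. Step 4: if $\ell_k>0$, set $x^{k+1}=x^k+(0.5)^{\ell_k}\alpha_0Q(x^k)d^k$; otherwise, using at most $m$ oracle calls, find $x^{k+1}\in\overline{\mathcal{F}}(x^k)$ with $f(x^{k+1})\le f_{x^k}(\alpha_0d^k)$. Algorithm 3 (monotone SPG, at $x^k$). Choose $\lambda_k^{\mathrm{spg}}\in[\lambda_{\min}^{\mathrm{spg}},\lambda_{\max}^{\mathrm{spg}}]$ and let $v^k$ be the minimizer of $\nabla f(x^k)^Tv+(\lambda_k^{\mathrm{spg}}/2)\|v\|^2$ subject to $x^k+v\in\Omega$, i.e. $v^k=P_\Omega(x^k-(1/\lambda_k^{\mathrm{spg}})\nabla f(x^k))-x^k$. Find the smallest nonnegative integer $j_k$ with $f(x^k+(0.5)^{j_k}v^k)\le f(x^k)+\rho(0.5)^{j_k}\langle\nabla f(x^k),v^k\rangle$ and set $x^{k+1}=x^k+(0.5)^{j_k}v^k$. *)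

theory Defs
  imports "HOL-Analysis.Analysis" "HOL-Library.Function_Algebras"
begin

text \<open>
  The dimension has to be quantified inside the statement (the complexity constant must not depend
  on it), so vectors of \<open>\<real>\<^sup>n\<close> are the points of the library space \<^const>\<open>Euclidean_space\<close>:
  sequences that vanish from index \<open>n\<close> on. Coordinates are numbered \<open>0, \<dots>, n - 1\<close>.
\<close>

type_synonym point = "nat \<Rightarrow> real"

abbreviation Rn :: "nat \<Rightarrow> point set" where
  "Rn n \<equiv> topspace (Euclidean_space n)"

definition scale :: "real \<Rightarrow> point \<Rightarrow> point" (infixr "\<odot>" 75) where
  "c \<odot> x = (\<lambda>i. c * x i)"

definition enorm :: "nat \<Rightarrow> point \<Rightarrow> real" where
  "enorm n x = L2_set x {..<n}"

definition einner :: "nat \<Rightarrow> point \<Rightarrow> point \<Rightarrow> real" where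
  "einner n x y = (\<Sum>i<n. x i * y i)"

definition partial :: "(point \<Rightarrow> real) \<Rightarrow> nat \<Rightarrow> point \<Rightarrow> real" where
  "partial F i x = deriv (\<lambda>t. F (x(i := t))) (x i)"

definition gradient :: "nat \<Rightarrow> (point \<Rightarrow> real) \<Rightarrow> point \<Rightarrow> point" where
  "gradient n F x = (\<lambda>i. if i < n then partial F i x else 0)"

definition C1 :: "nat \<Rightarrow> (point \<Rightarrow> real) \<Rightarrow> bool" where
  "C1 n F \<longleftrightarrow>
     continuous_map (Euclidean_space n) euclideanreal F \<and>
     (\<forall>i<n. (\<forall>x\<in>Rn n. (\<lambda>t. F (x(i := t))) differentiable (at (x i))) \<and>
            continuous_map (Euclidean_space n) euclideanreal (partial F i))"

definition C2 :: "nat \<Rightarrow> (point \<Rightarrow> real) \<Rightarrow> bool" where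
  "C2 n F \<longleftrightarrow> C1 n F \<and> (\<forall>i<n. C1 n (partial F i))"

record box_problem =
  nvars :: nat
  lower :: point
  upper :: point
  obj :: "point \<Rightarrow> real"

record alg_params =
  theta :: real
  rho :: real
  budget :: nat  \<comment> \<open>the number \<open>m\<close> of extra oracle calls allowed in Algorithm 2\<close>
  a1 :: real
  a2 :: real
  lam_min :: real
  lam_max :: real

definition Omega :: "box_problem \<Rightarrow> point set" where
  "Omega P = {x \<in> Rn (nvars P). \<forall>i<nvars P. lower P i \<le> x i \<and> x i \<le> upper P i}"

definition proj :: "box_problem \<Rightarrow> point \<Rightarrow> point" where
  "proj P x = (SOME z. z \<in> Omega P \<and>
     (\<forall>w\<in>Omega P. enorm (nvars P) (x - z) \<le> enorm (nvars P) (x - w)))"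

definition grad :: "box_problem \<Rightarrow> point \<Rightarrow> point" where
  "grad P = gradient (nvars P) (obj P)"

definition active0 :: "box_problem \<Rightarrow> point \<Rightarrow> nat set" where
  "active0 P x = {j. j < nvars P \<and> x j = lower P j}"

definition active1 :: "box_problem \<Rightarrow> point \<Rightarrow> nat set" where
  "active1 P x = {j. j < nvars P \<and> x j = upper P j}"

definition inactive :: "box_problem \<Rightarrow> point \<Rightarrow> nat set" where
  "inactive P x = {..<nvars P} - (active0 P x \<union> active1 P x)"

abbreviation ninactive :: "box_problem \<Rightarrow> point \<Rightarrow> nat" where
  "ninactive P x \<equiv> card (inactive P x)"

definition face :: "box_problem \<Rightarrow> point \<Rightarrow> point set" where
  "face P x = {z \<in> Omega P. \<forall>i<nvars P.
     (i \<in> active0 P x \<longrightarrow> z i = lower P i) \<and>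
     (i \<in> active1 P x \<longrightarrow> z i = upper P i) \<and>
     (i \<in> inactive P x \<longrightarrow> lower P i < z i \<and> z i < upper P i)}"

definition face_closure :: "box_problem \<Rightarrow> point \<Rightarrow> point set" where
  "face_closure P x = Euclidean_space (nvars P) closure_of face P x"

definition face_boundary :: "box_problem \<Rightarrow> point \<Rightarrow> point set" where
  "face_boundary P x = face_closure P x - face P x"

definition red_grad :: "box_problem \<Rightarrow> point \<Rightarrow> point" where
  "red_grad P x = x - proj P (x - grad P x)"

definition red_grad_inactive :: "box_problem \<Rightarrow> point \<Rightarrow> point" where
  "red_grad_inactive P x = (\<lambda>i. if i \<in> inactive P x then red_grad P x i else 0)"

text \<open>
  \<open>Q P x i j\<close> is the entry in row \<open>i\<close> and column \<open>j\<close> of \<open>Q(x)\<close>, and \<open>embed P x y\<close> is the product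
  \<open>Q(x) y\<close> for \<open>y\<close> of dimension \<^term>\<open>ninactive P x\<close>.
\<close>

definition Q :: "box_problem \<Rightarrow> point \<Rightarrow> nat \<Rightarrow> nat \<Rightarrow> real" where
  "Q P x i j = (if i = sorted_list_of_set (inactive P x) ! j then 1 else 0)"

definition embed :: "box_problem \<Rightarrow> point \<Rightarrow> point \<Rightarrow> point" where
  "embed P x y = (\<lambda>i. \<Sum>j<ninactive P x. Q P x i j * y j)"

definition obj_face :: "box_problem \<Rightarrow> point \<Rightarrow> point \<Rightarrow> real" where
  "obj_face P x y = obj P (x + embed P x y)"

definition grad_face :: "box_problem \<Rightarrow> point \<Rightarrow> point" where
  "grad_face P x = gradient (ninactive P x) (obj_face P x) 0"

text \<open>
  An iteration is specified together with the list of all oracle calls it makes. Nothing is reused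
  from earlier calls: a value that is needed again is charged again. For instance, the first trial
  of Step 3 is charged also if Step 2.3 has just evaluated the objective at that point.
\<close>

datatype query = Val point | Grad point | Hess point

text \<open>
  \<open>backtrack r \<phi> s l\<close>: \<open>l\<close> is the smallest exponent that passes the sufficient decrease test along
  the curve \<open>\<phi>\<close>, where \<open>s\<close> is the slope at \<open>0\<close>. The points tested are those with exponents
  \<open>0, \<dots>, l\<close>.
\<close>

definition armijo :: "real \<Rightarrow> (real \<Rightarrow> real) \<Rightarrow> real \<Rightarrow> nat \<Rightarrow> bool" where
  "armijo r \<phi> s l \<longleftrightarrow> \<phi> ((1/2) ^ l) \<le> \<phi> 0 + r * (1/2) ^ l * s"

definition backtrack :: "real \<Rightarrow> (real \<Rightarrow> real) \<Rightarrow> real \<Rightarrow> nat \<Rightarrow> bool" where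
  "backtrack r \<phi> s l \<longleftrightarrow> armijo r \<phi> s l \<and> (\<forall>j<l. \<not> armijo r \<phi> s j)"

definition trials :: "(real \<Rightarrow> point) \<Rightarrow> nat \<Rightarrow> query list" where
  "trials c l = map (\<lambda>j. Val (c ((1/2) ^ j))) [0..<Suc l]"

text \<open>
  Step 1 of Algorithm 2. No accuracy is prescribed for the approximate least-squares solution
  \<open>d1\<close> returned by MINRES, so \<open>d1\<close> is an arbitrary vector of dimension \<^term>\<open>ninactive P x\<close>.
\<close>

definition scaled_dir :: "alg_params \<Rightarrow> box_problem \<Rightarrow> point \<Rightarrow> point \<Rightarrow> point" where
  "scaled_dir A P x d1 =
     (let k = ninactive P x; g = grad_face P x;
          \<beta>1 = (if enorm k d1 \<le> a1 A * enorm k g then 1 else a1 A * enorm k g / enorm k d1)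
      in \<beta>1 \<odot> d1)"

definition search_dir :: "alg_params \<Rightarrow> box_problem \<Rightarrow> point \<Rightarrow> point \<Rightarrow> point" where
  "search_dir A P x d1 =
     (let k = ninactive P x; g = grad_face P x; d2 = scaled_dir A P x d1;
          \<beta>2 = (if einner k g d2 \<le> - a2 A * (enorm k g)\<^sup>2 then 1
                else (1 - a2 A) / (1 + einner k g d2 / (enorm k g)\<^sup>2))
      in \<beta>2 \<odot> d2 + (1 - \<beta>2) \<odot> (- g))"

definition tmax :: "box_problem \<Rightarrow> point \<Rightarrow> point \<Rightarrow> real" where
  "tmax P x d = (GREATEST t. 0 < t \<and> t \<le> 1 \<and> x + t \<odot> embed P x d \<in> Omega P)"

text \<open>Steps 3 and 4 of Algorithm 2, for the search direction \<open>d\<close> and the initial step \<open>\<alpha>\<close>.\<close>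

inductive alg2_search ::
  "alg_params \<Rightarrow> box_problem \<Rightarrow> point \<Rightarrow> point \<Rightarrow> real \<Rightarrow> query list \<Rightarrow> point \<Rightarrow> bool"
  for A P x d \<alpha> where
  positive:
    "\<lbrakk>backtrack (rho A) (\<lambda>t. obj_face P x ((t * \<alpha>) \<odot> d))
        (\<alpha> * einner (ninactive P x) (grad_face P x) d) l;
      l > 0\<rbrakk>
     \<Longrightarrow> alg2_search A P x d \<alpha> (trials (\<lambda>t. x + (t * \<alpha>) \<odot> embed P x d) l)
           (x + ((1/2) ^ l * \<alpha>) \<odot> embed P x d)"
| zero:
    "\<lbrakk>backtrack (rho A) (\<lambda>t. obj_face P x ((t * \<alpha>) \<odot> d))
        (\<alpha> * einner (ninactive P x) (grad_face P x) d) 0;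
      length es \<le> budget A;
      y \<in> face_closure P x; obj P y \<le> obj_face P x (\<alpha> \<odot> d)\<rbrakk>
     \<Longrightarrow> alg2_search A P x d \<alpha> (trials (\<lambda>t. x + (t * \<alpha>) \<odot> embed P x d) 0 @ es) y"

text \<open>
  Algorithm 2 at \<open>x\<close> with MINRES output \<open>d1\<close>. The gradient of the objective at \<open>x\<close> is already known
  from the stopping test and is charged there; it determines the reduced gradient.
\<close>

inductive alg2 ::
  "alg_params \<Rightarrow> box_problem \<Rightarrow> point \<Rightarrow> point \<Rightarrow> query list \<Rightarrow> point \<Rightarrow> bool"
  for A P d1 x where
  step2_1:
    "\<lbrakk>d = search_dir A P x d1;
      x + embed P x d \<in> face P x;
      alg2_search A P x d 1 qs y\<rbrakk>
     \<Longrightarrow> alg2 A P d1 x ([Hess x, Val x] @ qs) y"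
| step2_2:
    "\<lbrakk>d = search_dir A P x d1;
      x + embed P x d \<notin> face P x;
      p = proj P (x + embed P x d);
      obj P p \<le> obj_face P x 0;
      length es \<le> budget A;
      y \<in> face_boundary P x; obj P y \<le> obj P p\<rbrakk>
     \<Longrightarrow> alg2 A P d1 x ([Hess x, Val x, Val p] @ es) y"
| step2_3_stop:
    "\<lbrakk>d = search_dir A P x d1;
      x + embed P x d \<notin> face P x;
      p = proj P (x + embed P x d);
      \<not> obj P p \<le> obj_face P x 0;
      t = tmax P x d;
      obj_face P x (t \<odot> d) \<le> obj_face P x 0;
      length es \<le> budget A;
      y \<in> face_boundary P x; obj P y \<le> obj_face P x (t \<odot> d)\<rbrakk>
     \<Longrightarrow> alg2 A P d1 x ([Hess x, Val x, Val p, Val (x + t \<odot> embed P x d)] @ es) y"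
| step2_3_continue:
    "\<lbrakk>d = search_dir A P x d1;
      x + embed P x d \<notin> face P x;
      p = proj P (x + embed P x d);
      \<not> obj P p \<le> obj_face P x 0;
      t = tmax P x d;
      \<not> obj_face P x (t \<odot> d) \<le> obj_face P x 0;
      alg2_search A P x d t qs y\<rbrakk>
     \<Longrightarrow> alg2 A P d1 x ([Hess x, Val x, Val p, Val (x + t \<odot> embed P x d)] @ qs) y"

text \<open>Algorithm 3 at \<open>x\<close> with spectral parameter \<open>lam\<close>.\<close>

inductive alg3 ::
  "alg_params \<Rightarrow> box_problem \<Rightarrow> real \<Rightarrow> point \<Rightarrow> query list \<Rightarrow> point \<Rightarrow> bool"
  for A P lam x where
  "\<lbrakk>v = proj P (x - (1 / lam) \<odot> grad P x) - x;
    backtrack (rho A) (\<lambda>t. obj P (x + t \<odot> v)) (einner (nvars P) (grad P x) v) j\<rbrakk>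
   \<Longrightarrow> alg3 A P lam x ([Val x] @ trials (\<lambda>t. x + t \<odot> v) j) (x + (1/2) ^ j \<odot> v)"

text \<open>
  One iteration of Algorithm 1 at \<open>x\<close>. The choices that the method leaves open are the arguments
  \<open>d1\<close> and \<open>lam\<close>; only the one belonging to the subalgorithm that is called matters. The result is
  \<^const>\<open>None\<close> if the method stops at \<open>x\<close>, and the next iterate otherwise.
\<close>

inductive alg1_iter ::
  "alg_params \<Rightarrow> box_problem \<Rightarrow> real \<Rightarrow> point \<Rightarrow> real \<Rightarrow> point \<Rightarrow> query list \<Rightarrow> point option \<Rightarrow> bool"
  for A P eps d1 lam x where
  stop:
    "enorm (nvars P) (red_grad P x) \<le> eps \<Longrightarrow> alg1_iter A P eps d1 lam x [Grad x] None"
| inner: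
    "\<lbrakk>\<not> enorm (nvars P) (red_grad P x) \<le> eps;
      enorm (nvars P) (red_grad_inactive P x) \<ge> theta A * enorm (nvars P) (red_grad P x);
      alg2 A P d1 x qs y\<rbrakk>
     \<Longrightarrow> alg1_iter A P eps d1 lam x (Grad x # qs) (Some y)"
| leave:
    "\<lbrakk>\<not> enorm (nvars P) (red_grad P x) \<le> eps;
      \<not> enorm (nvars P) (red_grad_inactive P x) \<ge> theta A * enorm (nvars P) (red_grad P x);
      alg3 A P lam x qs y\<rbrakk>
     \<Longrightarrow> alg1_iter A P eps d1 lam x (Grad x # qs) (Some y)"

text \<open>
  \<open>alg1_run A P eps x0 xs qs N\<close>: the first \<open>N\<close> iterations of some execution from \<open>x0\<close>. Iteration
  \<open>k\<close> makes the calls \<open>qs k\<close>; once the method has stopped, all later entries are \<^const>\<open>None\<close>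
  and no further calls are made.
\<close>

definition alg1_run ::
  "alg_params \<Rightarrow> box_problem \<Rightarrow> real \<Rightarrow> point \<Rightarrow> (nat \<Rightarrow> point option) \<Rightarrow> (nat \<Rightarrow> query list) \<Rightarrow> nat \<Rightarrow> bool"
  where
  "alg1_run A P eps x0 xs qs N \<longleftrightarrow>
     xs 0 = Some x0 \<and>
     (\<forall>k<N. case xs k of
        None \<Rightarrow> qs k = [] \<and> xs (Suc k) = None
      | Some x \<Rightarrow> (\<exists>d1\<in>Rn (ninactive P x). \<exists>lam\<in>{lam_min A..lam_max A}.
          alg1_iter A P eps d1 lam x (qs k) (xs (Suc k))))"

end

theory Submission
  imports Defs
begin

text \<open>
  The projection acts coordinatewise and the search direction vanishes on the active coordinates,
  so all of Algorithm 2 takes place in \<open>\<real>\<^sup>n\<close>. The descent lemma bounds the number of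
  backtracking steps from above and the accepted step from below. Hence an iteration that does not
  stop either lowers the objective by a multiple of \<open>\<epsilon>\<^sup>2\<close>, or it does not raise the objective and
  moves to the boundary of the current face, which makes more constraints active. At most \<open>n\<close>
  iterations of the second kind can follow each other, which is where the factor \<open>n\<close> comes from.

  The count of oracle calls per iteration is within the bound because Step 3 cannot accept the first
  trial once Step 2.3 has found no decrease at the same point: the \<open>m\<close> calls of Step 4 are then not
  made.
\<close>

section \<open>Vectors\<close>

text \<open>The delicate case is the end of Step 2.3: its initial step \<open>tmax\<close> can be
  arbitrarily small, so accepting the first trial there would give a decrease with no uniform lower
  bound. Since no decrease was found at \<open>tmax\<close>, at least one halving takes place, and
  the trial rejected just before the accepted one bounds the step from below independently of
  \<open>tmax\<close>. In Algorithm 2 the threshold that a rejected trial must exceed is four times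
  the quantity inside the logarithm. These two binary units let the logarithm pay for all trials, so
  that the term 5 pays for the gradient, the Hessian and the three values computed before the
  search. \<open>L\<close> may be 0, where the quotients in the bound degenerate. No trial is ever
  rejected then, and the decrease constants use \<open>max L 1\<close>. Smoothness is expressed
  through partial derivatives. Differentiability along a direction is recovered from an error
  estimate whose constant contains \<open>n\<close>; this constant vanishes in the limit, and the
  descent inequality is free of the dimension.\<close>

lemma Rn_iff: "x \<in> Rn n \<longleftrightarrow> (\<forall>i\<ge>n. x i = 0)"
  by (simp add: topspace_Euclidean_space)

lemma enorm_nonneg [simp]: "0 \<le> enorm n x"
  by (simp add: enorm_def)

lemma enorm_sq: "(enorm n x)\<^sup>2 = (\<Sum>i<n. (x i)\<^sup>2)"
  by (simp add: enorm_def L2_set_def sum_nonneg)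

lemma enorm_mono:
  assumes "\<And>i. i < n \<Longrightarrow> \<bar>x i\<bar> \<le> \<bar>y i\<bar>"
  shows "enorm n x \<le> enorm n y"
  unfolding enorm_def L2_set_def
  using assms by (intro real_sqrt_le_mono sum_mono) (simp add: abs_le_square_iff)

lemma abs_le_enorm: "i < n \<Longrightarrow> \<bar>x i\<bar> \<le> enorm n x"
  unfolding enorm_def L2_set_def
  by (rule real_le_rsqrt) (simp add: member_le_sum[of i "{..<n}" "\<lambda>i. (x i)\<^sup>2", simplified])

lemma enorm_scale: "enorm n (c \<odot> x) = \<bar>c\<bar> * enorm n x"
  by (simp add: enorm_def L2_set_def scale_def power_mult_distrib real_sqrt_mult
      flip: sum_distrib_left)

lemma enorm_add_le: "enorm n (x + y) \<le> enorm n x + enorm n y"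
  using L2_set_triangle_ineq[of x y "{..<n}"] by (simp add: enorm_def plus_fun_def)

lemma enorm_uminus [simp]: "enorm n (- x) = enorm n x"
  by (simp add: enorm_def L2_set_def)

lemma einner_le: "einner n x y \<le> enorm n x * enorm n y"
proof -
  have "einner n x y \<le> (\<Sum>i<n. \<bar>x i\<bar> * \<bar>y i\<bar>)"
    unfolding einner_def by (intro sum_mono) (metis abs_ge_self abs_mult)
  also have "\<dots> \<le> enorm n x * enorm n y"
    unfolding enorm_def by (rule L2_set_mult_ineq)
  finally show ?thesis .
qed

lemma einner_self: "einner n x x = (enorm n x)\<^sup>2"
  by (simp add: enorm_sq einner_def flip: power2_eq_square)

lemma einner_scale_right: "einner n x (c \<odot> y) = c * einner n x y"
  by (simp add: einner_def scale_def sum_distrib_left mult_ac)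

lemma einner_add_right: "einner n x (y + z) = einner n x y + einner n x z"
  by (simp add: einner_def sum.distrib algebra_simps)

lemma einner_uminus_right: "einner n x (- y) = - einner n x y"
  by (simp add: einner_def sum_negf)

lemma einner_diff_left: "einner n (x - y) z = einner n x z - einner n y z"
  by (simp add: einner_def sum_subtractf algebra_simps)

lemma scale_scale: "a \<odot> (b \<odot> x) = (a * b) \<odot> x"
  by (simp add: scale_def mult_ac)

lemma scale_one [simp]: "1 \<odot> x = x"
  by (simp add: scale_def)

lemma scale_zero [simp]: "0 \<odot> x = 0"
  by (simp add: scale_def zero_fun_def)

lemma add_mem_Rn: "x \<in> Rn n \<Longrightarrow> y \<in> Rn n \<Longrightarrow> x + y \<in> Rn n"
  by (simp add: Rn_iff)

lemma scale_mem_Rn: "x \<in> Rn n \<Longrightarrow> c \<odot> x \<in> Rn n"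
  by (simp add: Rn_iff scale_def)

section \<open>Descent along a direction\<close>

text \<open>After division by \<open>h\<close> the error is at most \<open>K * |h|\<close>, so
  \<open>K\<close> leaves no trace in the limit and may depend on the dimension.\<close>

lemma has_real_derivative_quadratic_error:
  fixes \<phi> :: "real \<Rightarrow> real"
  assumes "\<And>h. \<bar>\<phi> (t + h) - \<phi> t - h * D\<bar> \<le> K * h\<^sup>2"
  shows "(\<phi> has_real_derivative D) (at t)"
proof -
  have "((\<lambda>h. (\<phi> (t + h) - \<phi> t) / h - D) \<longlongrightarrow> 0) (at 0)"
  proof (rule Lim_null_comparison)
    show "\<forall>\<^sub>F h in at 0. norm ((\<phi> (t + h) - \<phi> t) / h - D) \<le> K * \<bar>h\<bar>"
      unfolding eventually_at_filter
    proof (intro always_eventually allI impI)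
      fix h :: real assume h: "h \<noteq> 0"
      have "norm ((\<phi> (t + h) - \<phi> t) / h - D) = \<bar>\<phi> (t + h) - \<phi> t - h * D\<bar> / \<bar>h\<bar>"
        using h by (simp add: diff_divide_distrib flip: abs_divide)
      also have "\<dots> \<le> K * h\<^sup>2 / \<bar>h\<bar>"
        using assms by (intro divide_right_mono) auto
      also have "\<dots> = K * \<bar>h\<bar>"
        using h by (simp add: power2_eq_square divide_simps abs_if)
      finally show "norm ((\<phi> (t + h) - \<phi> t) / h - D) \<le> K * \<bar>h\<bar>" .
    qed
    have "((\<lambda>h::real. K * \<bar>h\<bar>) \<longlongrightarrow> K * \<bar>0\<bar>) (at 0)"
      by (intro tendsto_intros)
    then show "((\<lambda>h::real. K * \<bar>h\<bar>) \<longlongrightarrow> 0) (at 0)" by simp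
  qed
  then show ?thesis
    unfolding DERIV_def by (rule LIM_zero_cancel)
qed

text \<open>\<open>proj\<close> is given only by a choice operator; this is the closed form that
  \<open>proj_eq_clip\<close> establishes for it.\<close>

definition clip :: "box_problem \<Rightarrow> point \<Rightarrow> point" where
  "clip P x = (\<lambda>i. if i < nvars P then max (lower P i) (min (upper P i) (x i)) else 0)"

locale smooth_box =
  fixes P :: box_problem and L :: real
  assumes nvars_pos: "0 < nvars P"
    and lower_less_upper: "\<And>i. i < nvars P \<Longrightarrow> lower P i < upper P i"
    and partial_differentiable:
      "\<And>i x. i < nvars P \<Longrightarrow> x \<in> Rn (nvars P) \<Longrightarrow> (\<lambda>t. obj P (x(i := t))) differentiable (at (x i))"
    and grad_Lipschitz:
      "\<And>x y. x \<in> Rn (nvars P) \<Longrightarrow> y \<in> Rn (nvars P) \<Longrightarrow>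
         enorm (nvars P) (grad P x - grad P y) \<le> L * enorm (nvars P) (x - y)"
begin

abbreviation "n \<equiv> nvars P"
abbreviation "f \<equiv> obj P"

lemma L_nonneg: "0 \<le> L"
proof -
  let ?e = "(\<lambda>i. if i = 0 then 1 else 0) :: point"
  have e: "enorm n (?e - 0) > 0"
    using abs_le_enorm[of 0 n "?e - 0"] nvars_pos by simp
  have "0 \<le> enorm n (grad P ?e - grad P 0)" by simp
  also have "\<dots> \<le> L * enorm n (?e - 0)"
    using nvars_pos by (intro grad_Lipschitz) (auto simp: Rn_iff)
  finally show ?thesis using e by (simp add: zero_le_mult_iff)
qed

lemma has_partial_derivative:
  assumes "i < n" "x \<in> Rn n"
  shows "((\<lambda>t. f (x(i := t))) has_real_derivative grad P (x(i := t)) i) (at t)"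
proof -
  have "x(i := t) \<in> Rn n" using assms by (auto simp: Rn_iff)
  from partial_differentiable[OF assms(1) this]
  have "(\<lambda>s. f (x(i := s))) differentiable (at t)" by simp
  then show ?thesis
    using assms by (simp add: grad_def gradient_def partial_def DERIV_deriv_iff_real_differentiable)
qed

text \<open>
  The increment is split along a path that moves one coordinate at a time, so only the partial
  derivatives and their Lipschitz continuity are involved.
\<close>

lemma first_order_error:
  assumes x: "x \<in> Rn n" and v: "v \<in> Rn n"
  shows "\<bar>f (x + v) - f x - einner n (grad P x) v\<bar> \<le> real n * L * (enorm n v)\<^sup>2"
proof -
  define h where "h = (\<lambda>i. (\<lambda>j. if j < i then x j + v j else x j) :: point)"
  have h0: "h 0 = x" by (simp add: h_def)
  have hn: "h n = x + v" using v by (auto simp: h_def Rn_iff)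
  have hR: "h i \<in> Rn n" for i using x v by (auto simp: h_def Rn_iff)
  have step: "\<bar>f (h (Suc i)) - f (h i) - grad P x i * v i\<bar> \<le> L * (enorm n v)\<^sup>2"
    if i: "i < n" for i
  proof -
    define S where "S = closed_segment (x i) (x i + v i)"
    let ?\<phi> = "\<lambda>t. f ((h i)(i := t)) - grad P x i * t"
    have "norm (?\<phi> (x i + v i) - ?\<phi> (x i)) \<le> (L * enorm n v) * norm (x i + v i - x i)"
    proof (rule field_differentiable_bound)
      show "convex S" by (simp add: S_def)
      fix t assume "t \<in> S"
      show "(?\<phi> has_field_derivative (grad P ((h i)(i := t)) i - grad P x i)) (at t within S)"
        by (rule has_field_derivative_at_within)
          (auto intro!: derivative_eq_intros has_partial_derivative[OF i hR])
      let ?z = "(h i)(i := t)"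
      have z: "?z \<in> Rn n" using hR[of i] i by (auto simp: Rn_iff)
      have "norm (grad P ?z i - grad P x i) \<le> enorm n (grad P ?z - grad P x)"
        using abs_le_enorm[OF i, of "grad P ?z - grad P x"] by simp
      also have "\<dots> \<le> L * enorm n (?z - x)"
        by (rule grad_Lipschitz[OF z x])
      also have "\<dots> \<le> L * enorm n v"
      \<comment> \<open>Each coordinate of \<open>?z - x\<close> lies between 0 and that of
        \<open>v\<close>, however much of the path has been covered, so all legs share the bound
        \<open>L * enorm n v\<close>.\<close>
      proof (intro mult_left_mono enorm_mono L_nonneg)
        fix j
        show "\<bar>(?z - x) j\<bar> \<le> \<bar>v j\<bar>"
          using \<open>t \<in> S\<close> by (auto simp: S_def h_def closed_segment_eq_real_ivl split: if_splits)
      qed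
      finally show "norm (grad P ?z i - grad P x i) \<le> L * enorm n v" .
    qed (auto simp: S_def)
    moreover have "(h i)(i := x i + v i) = h (Suc i)" "(h i)(i := x i) = h i"
      by (auto simp: h_def fun_eq_iff less_Suc_eq)
    ultimately have "\<bar>f (h (Suc i)) - f (h i) - grad P x i * v i\<bar> \<le> L * enorm n v * \<bar>v i\<bar>"
      by (simp add: algebra_simps)
    also have "\<dots> \<le> L * enorm n v * enorm n v"
      using abs_le_enorm[OF i] L_nonneg by (intro mult_left_mono) auto
    finally show ?thesis by (simp add: power2_eq_square mult_ac)
  qed
  have "f (x + v) - f x = (\<Sum>i<n. f (h (Suc i)) - f (h i))"
    by (subst sum_lessThan_telescope) (simp add: h0 hn)
  then have "f (x + v) - f x - einner n (grad P x) v
      = (\<Sum>i<n. f (h (Suc i)) - f (h i) - grad P x i * v i)"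
    by (simp add: einner_def sum_subtractf)
  also have "\<bar>\<dots>\<bar> \<le> (\<Sum>i<n. L * (enorm n v)\<^sup>2)"
    using step by (intro order_trans[OF sum_abs] sum_mono) auto
  finally show ?thesis by (simp add: mult_ac)
qed

lemma has_directional_derivative:
  assumes x: "x \<in> Rn n" and v: "v \<in> Rn n"
  shows "((\<lambda>t. f (x + t \<odot> v)) has_real_derivative einner n (grad P (x + t \<odot> v)) v) (at t)"
proof (rule has_real_derivative_quadratic_error[where K = "real n * L * (enorm n v)\<^sup>2"])
  fix h
  have "x + (t + h) \<odot> v = (x + t \<odot> v) + h \<odot> v"
    by (auto simp: scale_def algebra_simps)
  then show "\<bar>f (x + (t + h) \<odot> v) - f (x + t \<odot> v) - h * einner n (grad P (x + t \<odot> v)) v\<bar>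
      \<le> real n * L * (enorm n v)\<^sup>2 * h\<^sup>2"
    using first_order_error[OF add_mem_Rn[OF x scale_mem_Rn[OF v]] scale_mem_Rn[OF v], of t h]
    by (simp add: einner_scale_right enorm_scale power_mult_distrib mult_ac add.assoc)
qed

text \<open>The difference of the two sides has a nonpositive derivative in \<open>t\<close>, by
  Cauchy-Schwarz and the Lipschitz condition on the ray. Unlike in \<open>first_order_error\<close>,
  the constant does not contain \<open>n\<close>.\<close>

lemma descent:
  assumes x: "x \<in> Rn n" and v: "v \<in> Rn n" and t: "0 \<le> t"
  shows "f (x + t \<odot> v) \<le> f x + t * einner n (grad P x) v + L / 2 * t\<^sup>2 * (enorm n v)\<^sup>2"
proof -
  let ?s = "einner n (grad P x) v"
  let ?\<psi> = "\<lambda>t. f (x + t \<odot> v) - t * ?s - L / 2 * t\<^sup>2 * (enorm n v)\<^sup>2"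
  have "?\<psi> t \<le> ?\<psi> 0"
  proof (rule DERIV_nonpos_imp_nonincreasing[OF t])
    fix a assume a: "0 \<le> a" "a \<le> t"
    let ?D = "einner n (grad P (x + a \<odot> v)) v - ?s - L * a * (enorm n v)\<^sup>2"
    have "(?\<psi> has_real_derivative ?D) (at a)"
      by (auto intro!: derivative_eq_intros has_directional_derivative[OF x v])
    moreover have "?D \<le> 0"
    proof -
      have "einner n (grad P (x + a \<odot> v)) v - ?s \<le> enorm n (grad P (x + a \<odot> v) - grad P x) * enorm n v"
        using einner_le[of n "grad P (x + a \<odot> v) - grad P x" v] by (simp add: einner_diff_left)
      also have "\<dots> \<le> (L * enorm n (x + a \<odot> v - x)) * enorm n v"
        by (intro mult_right_mono grad_Lipschitz add_mem_Rn scale_mem_Rn x v) simp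
      also have "\<dots> = L * a * (enorm n v)\<^sup>2"
        using a by (simp add: enorm_scale power2_eq_square)
      finally show ?thesis by simp
    qed
    ultimately show "\<exists>y. (?\<psi> has_real_derivative y) (at a) \<and> y \<le> 0" by blast
  qed
  then show ?thesis by simp
qed

text \<open>The failed test and \<open>descent\<close> bound the same value from below and from
  above; cancelling one factor of the positive step leaves a lower bound on the step. Algorithm 2
  uses its initial step as \<open>\<alpha>\<close>, Algorithm 3 uses 1.\<close>

lemma armijo_fails:
  assumes x: "x \<in> Rn n" and v: "v \<in> Rn n" and \<alpha>: "0 < \<alpha>"
    and fails: "\<not> armijo r (\<lambda>t. f (x + (t * \<alpha>) \<odot> v)) (\<alpha> * einner n (grad P x) v) j"
  shows "2 * (1 - r) * (- einner n (grad P x) v) < L * ((1/2) ^ j * \<alpha>) * (enorm n v)\<^sup>2"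
proof -
  let ?s = "einner n (grad P x) v" and ?t = "(1/2) ^ j * \<alpha>"
  have t: "0 < ?t" using \<alpha> by simp
  have "f x + r * ?t * ?s < f (x + ?t \<odot> v)"
    using fails by (simp add: armijo_def mult.assoc)
  also have "\<dots> \<le> f x + ?t * ?s + L / 2 * ?t\<^sup>2 * (enorm n v)\<^sup>2"
    using t by (intro descent x v) simp
  finally have "?t * (2 * (1 - r) * (- ?s)) < ?t * (L * ?t * (enorm n v)\<^sup>2)"
    by (simp add: algebra_simps power2_eq_square)
  then show ?thesis
    using t by (simp only: mult_less_cancel_left_pos)
qed

section \<open>Faces and projections\<close>

lemma Omega_iff: "x \<in> Omega P \<longleftrightarrow> x \<in> Rn n \<and> (\<forall>i<n. lower P i \<le> x i \<and> x i \<le> upper P i)"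
  by (simp add: Omega_def)

lemma Omega_subset_Rn: "x \<in> Omega P \<Longrightarrow> x \<in> Rn n"
  by (simp add: Omega_iff)

lemma clip_mem_Omega: "clip P x \<in> Omega P"
  using lower_less_upper by (auto simp: Omega_iff Rn_iff clip_def intro: less_imp_le)

text \<open>Clipping is at least as close as any point of the box in every coordinate separately. A
  minimizer therefore ties with it term by term, not only in the sum of squares.\<close>

lemma proj_eq_clip: "proj P x = clip P x"
proof -
  have coord: "\<bar>x i - clip P x i\<bar> \<le> \<bar>x i - w i\<bar>" if "w \<in> Omega P" "i < n" for w i
    using that by (auto simp: Omega_iff clip_def max_def min_def)
  show ?thesis
    unfolding proj_def
  proof (rule some_equality)
    show "clip P x \<in> Omega P \<and> (\<forall>w\<in>Omega P. enorm n (x - clip P x) \<le> enorm n (x - w))"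
      using clip_mem_Omega coord by (auto intro!: enorm_mono)
  next
    fix z assume z: "z \<in> Omega P \<and> (\<forall>w\<in>Omega P. enorm n (x - z) \<le> enorm n (x - w))"
    have "(enorm n (x - z))\<^sup>2 \<le> (enorm n (x - clip P x))\<^sup>2"
      using z clip_mem_Omega by (intro power_mono) auto
    then have le: "(\<Sum>i<n. (x i - z i)\<^sup>2) \<le> (\<Sum>i<n. (x i - clip P x i)\<^sup>2)"
      by (simp add: enorm_sq)
    have ge: "(x i - clip P x i)\<^sup>2 \<le> (x i - z i)\<^sup>2" if "i < n" for i
      using coord that z by (simp add: abs_le_square_iff)
    have eq: "z i = clip P x i" if i: "i < n" for i
    proof -
      have "(\<Sum>i<n. (x i - z i)\<^sup>2 - (x i - clip P x i)\<^sup>2) = 0"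
        using le ge by (intro antisym sum_nonneg) (auto simp: sum_subtractf)
      then have "(x i - z i)\<^sup>2 = (x i - clip P x i)\<^sup>2"
        using ge i by (subst (asm) sum_nonneg_eq_0_iff) auto
      \<comment> \<open>Equal squares leave only the mirror image of the clipped value about
        \<open>x i\<close> as an alternative, and that lies outside the interval unless it coincides
        with the clipped value.\<close>
      then show ?thesis
        using i z by (auto simp: power2_eq_iff Omega_iff clip_def max_def min_def split: if_splits)
    qed
    show "z = clip P x"
    proof
      fix i show "z i = clip P x i"
        using eq[of i] z by (cases "i < n") (auto simp: Omega_iff Rn_iff clip_def)
    qed
  qed
qed

section \<open>Inactive coordinates, the closure and the boundary of a face\<close>

lemma inactive_iff:
  "x \<in> Omega P \<Longrightarrow> i \<in> inactive P x \<longleftrightarrow> i < n \<and> lower P i < x i \<and> x i < upper P i"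
  by (auto simp: inactive_def active0_def active1_def Omega_iff order.order_iff_strict)

lemma finite_inactive [simp]: "finite (inactive P x)"
  by (simp add: inactive_def)

lemma inactive_less: "i \<in> inactive P x \<Longrightarrow> i < n"
  by (simp add: inactive_def)

lemma ninactive_le: "ninactive P x \<le> n"
  using card_mono[of "{..<n}" "inactive P x"] by (auto simp: inactive_def)

text \<open>The right-hand set is closed, as a finite intersection of preimages of closed sets, and
  contains the face. Conversely, the points \<open>z + t \<odot> (x - z)\<close> with 0 < t < 1 lie
  in the face, because \<open>x\<close> is strictly between its bounds in the inactive coordinates,
  and they tend to \<open>z\<close>.\<close>

lemma face_closure_iff:
  assumes x: "x \<in> Omega P"
  shows "z \<in> face_closure P x \<longleftrightarrow> z \<in> Omega P \<and> (\<forall>i<n. i \<notin> inactive P x \<longrightarrow> z i = x i)"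
proof -
  let ?E = "Euclidean_space n"
  let ?F = "{z \<in> Omega P. \<forall>i<n. i \<notin> inactive P x \<longrightarrow> z i = x i}"
  have proj: "continuous_map ?E euclideanreal (\<lambda>z. z i)" for i
    unfolding Euclidean_space_def
    using continuous_map_product_projection[of i UNIV "\<lambda>_. euclideanreal"]
    by (intro continuous_map_from_subtopology) simp
  let ?B = "\<lambda>i. if i \<in> inactive P x then {lower P i..upper P i} else {x i}"
  have "(lower P i \<le> z i \<and> z i \<le> upper P i) \<and> (i \<notin> inactive P x \<longrightarrow> z i = x i) \<longleftrightarrow> z i \<in> ?B i"
    if "i < n" for z i
    using x that by (auto simp: Omega_iff)
  then have "?F = {z \<in> Rn n. \<forall>i<n. z i \<in> ?B i}"
    unfolding Omega_iff by blast
  also have "\<dots> = (\<Inter>i\<in>{..<n}. {z \<in> Rn n. z i \<in> ?B i})"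
    using nvars_pos by blast
  finally have eq: "?F = (\<Inter>i\<in>{..<n}. {z \<in> Rn n. z i \<in> ?B i})" .
  have "closedin ?E ?F"
    unfolding eq using nvars_pos
    by (intro closedin_INT closedin_continuous_map_preimage[OF proj]) auto
  moreover have "face P x \<subseteq> ?F"
    using x by (auto simp: face_def inactive_def active0_def active1_def)
  ultimately have "face_closure P x \<subseteq> ?F"
    unfolding face_closure_def by (rule closure_of_minimal[rotated])
  moreover have "z \<in> face_closure P x" if z: "z \<in> ?F"
  proof -
    let ?c = "\<lambda>t. z + t \<odot> (x - z)"
    have zx: "z \<in> Rn n" "x \<in> Rn n" using z x by (auto simp: Omega_iff)
    have "continuous_map euclideanreal ?E ?c"
      unfolding Euclidean_space_def continuous_map_in_subtopology
      using zx by (auto simp: continuous_map_componentwise_UNIV Rn_iff scale_def intro!: continuous_intros)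
    then have "?c ` (euclideanreal closure_of {0<..<1}) \<subseteq> ?E closure_of (?c ` {0<..<1})"
      by (rule continuous_map_image_closure_subset)
    moreover have "?c ` {0<..<1} \<subseteq> face P x"
    proof clarify
      fix t :: real assume t: "t \<in> {0<..<1}"
      have "?c t i = x i" if "i < n" "i \<notin> inactive P x" for i
        using z that by (simp add: scale_def)
      moreover have "lower P i < ?c t i \<and> ?c t i < upper P i" if i: "i \<in> inactive P x" for i
      proof -
        have "lower P i < x i" "x i < upper P i" "lower P i \<le> z i" "z i \<le> upper P i"
          using z i x inactive_iff[OF x, of i] by (auto simp: Omega_iff)
        then have "t * lower P i < t * x i" "t * x i < t * upper P i"
          "(1 - t) * lower P i \<le> (1 - t) * z i" "(1 - t) * z i \<le> (1 - t) * upper P i"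
          using t by (auto intro!: mult_left_mono)
        then show ?thesis by (simp add: scale_def algebra_simps)
      qed
      moreover have "?c t \<in> Rn n" using zx by (intro add_mem_Rn scale_mem_Rn) (auto simp: Rn_iff)
      ultimately show "?c t \<in> face P x"
        using x unfolding face_def Omega_iff
        by (auto simp: inactive_def active0_def active1_def dest: less_imp_le) (metis less_imp_le)+
    qed
    ultimately have "?c ` (euclideanreal closure_of {0<..<1}) \<subseteq> ?E closure_of face P x"
      by (meson closure_of_mono order_trans)
    moreover have "0 \<in> euclideanreal closure_of {0<..<1}" by simp
    ultimately have "?c 0 \<in> ?E closure_of face P x" by blast
    then show ?thesis by (simp add: face_closure_def)
  qed
  ultimately show ?thesis by blast
qed

lemma face_iff:
  assumes x: "x \<in> Omega P"
  shows "z \<in> face P x \<longleftrightarrow> z \<in> face_closure P x \<and> (\<forall>i\<in>inactive P x. lower P i < z i \<and> z i < upper P i)"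
  unfolding face_closure_iff[OF x]
  by (auto simp: face_def inactive_def active0_def active1_def)

lemma self_mem_face: "x \<in> Omega P \<Longrightarrow> x \<in> face P x"
  by (simp add: face_iff face_closure_iff inactive_iff)

text \<open>A boundary point reaches a bound in some coordinate that is free at \<open>x\<close>,
  while the coordinates fixed at \<open>x\<close> stay fixed.\<close>

lemma ninactive_face_boundary_less:
  assumes x: "x \<in> Omega P" and y: "y \<in> face_boundary P x"
  shows "y \<in> Omega P" "ninactive P y < ninactive P x"
proof -
  have yc: "y \<in> face_closure P x" and yf: "y \<notin> face P x"
    using y by (auto simp: face_boundary_def)
  show yO: "y \<in> Omega P" using yc x by (simp add: face_closure_iff)
  obtain i where i: "i \<in> inactive P x" "\<not> (lower P i < y i \<and> y i < upper P i)"
    using yc yf by (auto simp: face_iff[OF x])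
  then have "i \<notin> inactive P y" using yO by (simp add: inactive_iff)
  moreover have "inactive P y \<subseteq> inactive P x"
  proof
    fix j assume j: "j \<in> inactive P y"
    show "j \<in> inactive P x"
    proof (rule ccontr)
      assume nj: "j \<notin> inactive P x"
      then have "y j = x j" using yc x j by (auto simp: face_closure_iff dest: inactive_less)
      then show False using j nj x yO by (simp add: inactive_iff)
    qed
  qed
  ultimately have "inactive P y \<subset> inactive P x" using i by blast
  then show "ninactive P y < ninactive P x" by (intro psubset_card_mono) simp_all
qed

lemma Omega_convex_step:
  assumes "x \<in> Omega P" "x + v \<in> Omega P" "0 \<le> s" "s \<le> 1"
  shows "x + s \<odot> v \<in> Omega P"
proof -
  have "lower P i \<le> x i + s * v i \<and> x i + s * v i \<le> upper P i" if i: "i < n" for i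
  proof -
    have "lower P i \<le> x i" "x i \<le> upper P i" "lower P i \<le> x i + v i" "x i + v i \<le> upper P i"
      using assms i by (auto simp: Omega_iff)
    then have "(1 - s) * lower P i \<le> (1 - s) * x i" "(1 - s) * x i \<le> (1 - s) * upper P i"
      "s * lower P i \<le> s * (x i + v i)" "s * (x i + v i) \<le> s * upper P i"
      using assms by (auto intro!: mult_left_mono simp del: distrib_left)
    then show ?thesis by (simp add: algebra_simps)
  qed
  moreover have "x + s \<odot> v \<in> Rn n"
    using assms by (auto simp: Omega_iff Rn_iff scale_def)
  ultimately show ?thesis by (simp add: Omega_iff scale_def)
qed

section \<open>Coordinates on a face: the matrix Q and the restricted gradient\<close>

lemma bij_betw_inactive:
  "bij_betw ((!) (sorted_list_of_set (inactive P x))) {..<ninactive P x} (inactive P x)"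
  by (rule bij_betw_nth) auto

lemma embed_nth:
  assumes "j < ninactive P x"
  shows "embed P x y (sorted_list_of_set (inactive P x) ! j) = y j"
proof -
  have "embed P x y (sorted_list_of_set (inactive P x) ! j)
      = (\<Sum>k<ninactive P x. if j = k then y k else 0)"
    unfolding embed_def Q_def using assms
    by (intro sum.cong) (auto simp: nth_eq_iff_index_eq)
  then show ?thesis using assms by simp
qed

lemma embed_active:
  assumes "i \<notin> inactive P x"
  shows "embed P x y i = 0"
  unfolding embed_def Q_def
proof (intro sum.neutral ballI)
  fix j assume "j \<in> {..<ninactive P x}"
  then have "sorted_list_of_set (inactive P x) ! j \<in> inactive P x"
    using bij_betwE[OF bij_betw_inactive, of x] by simp
  then show "(if i = sorted_list_of_set (inactive P x) ! j then 1 else 0) * y j = 0"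
    using assms by auto
qed

lemma embed_scale: "embed P x (c \<odot> d) = c \<odot> embed P x d"
  by (simp add: embed_def scale_def sum_distrib_left mult_ac)

lemma obj_face_eq: "obj_face P x d = f (x + embed P x d)"
  by (simp add: obj_face_def)

lemma obj_face_zero: "obj_face P x 0 = f x"
  by (simp add: obj_face_def embed_def zero_fun_def plus_fun_def)

lemma embed_mem_Rn: "embed P x d \<in> Rn n"
  by (auto simp: Rn_iff intro!: embed_active dest: inactive_less)

lemma sum_inactive:
  assumes "\<And>i. i \<notin> inactive P x \<Longrightarrow> h i = 0"
  shows "(\<Sum>i<n. h i) = (\<Sum>j<ninactive P x. h (sorted_list_of_set (inactive P x) ! j))"
proof -
  have "(\<Sum>i<n. h i) = (\<Sum>i\<in>inactive P x. h i)"
    using assms by (intro sum.mono_neutral_right) (auto dest: inactive_less)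
  also have "\<dots> = (\<Sum>j<ninactive P x. h (sorted_list_of_set (inactive P x) ! j))"
    by (rule sum.reindex_bij_betw[OF bij_betw_inactive, symmetric])
  finally show ?thesis .
qed

text \<open>Moving face coordinate \<open>j\<close> from 0 to \<open>t\<close> moves exactly one
  coordinate of \<open>x\<close>, from \<open>x i\<close> to \<open>t + x i\<close>. The two
  functions of one variable differ by a shift, so no chain rule is involved.\<close>

lemma grad_face_nth:
  assumes x: "x \<in> Rn n" and j: "j < ninactive P x"
  shows "grad_face P x j = grad P x (sorted_list_of_set (inactive P x) ! j)"
proof -
  define i where "i = sorted_list_of_set (inactive P x) ! j"
  have iI: "i \<in> inactive P x" unfolding i_def using bij_betwE[OF bij_betw_inactive] j by blast
  have "x + embed P x (0(j := t)) = x(i := t + x i)" for t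
  proof
    fix k show "(x + embed P x (0(j := t))) k = (x(i := t + x i)) k"
    proof (cases "k \<in> inactive P x")
      case True
      then obtain j' where j': "j' < ninactive P x" "k = sorted_list_of_set (inactive P x) ! j'"
        using bij_betw_imp_surj_on[OF bij_betw_inactive[of x]] by blast
      then have "embed P x (0(j := t)) k = (0(j := t)) j'" using embed_nth by simp
      moreover have "k = i \<longleftrightarrow> j' = j" using j j' by (simp add: i_def nth_eq_iff_index_eq)
      ultimately show ?thesis by (cases "k = i") auto
    next
      case False
      then show ?thesis using iI embed_active[OF False] by auto
    qed
  qed
  then have "grad_face P x j = deriv (\<lambda>t. f (x(i := t + x i))) 0"
    using j by (simp add: grad_face_def gradient_def partial_def obj_face_eq)
  also have "\<dots> = grad P x i"
    using has_partial_derivative[of i x "x i"] iI x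
    by (intro DERIV_imp_deriv)
      (auto dest: inactive_less simp flip: DERIV_shift[where f="\<lambda>t. f (x(i := t))"])
  finally show ?thesis by (simp add: i_def)
qed

lemma einner_embed:
  assumes "x \<in> Rn n"
  shows "einner n (grad P x) (embed P x d) = einner (ninactive P x) (grad_face P x) d"
  unfolding einner_def using assms
  by (subst sum_inactive[of x]) (auto simp: embed_active embed_nth grad_face_nth intro!: sum.cong)

lemma enorm_embed: "enorm n (embed P x d) = enorm (ninactive P x) d"
  unfolding enorm_def L2_set_def
  by (subst sum_inactive[of x]) (auto simp: embed_active embed_nth intro!: sum.cong)

lemma embed_grad_face:
  assumes "x \<in> Rn n" "i \<in> inactive P x"
  shows "embed P x (grad_face P x) i = grad P x i"
proof -
  obtain j where "j < ninactive P x" "i = sorted_list_of_set (inactive P x) ! j"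
    using bij_betw_imp_surj_on[OF bij_betw_inactive[of x]] assms(2) by blast
  then show ?thesis using assms by (simp add: embed_nth grad_face_nth)
qed

lemma red_grad_nth: "x \<in> Omega P \<Longrightarrow> i < n \<Longrightarrow>
    red_grad P x i = x i - max (lower P i) (min (upper P i) (x i - grad P x i))"
  by (simp add: red_grad_def proj_eq_clip clip_def)

text \<open>From a point of the box, clipping can only shorten the gradient step. This turns the
  branching test of Algorithm 1 into a lower bound on the face gradient.\<close>

lemma enorm_red_grad_inactive_le:
  assumes x: "x \<in> Omega P"
  shows "enorm n (red_grad_inactive P x) \<le> enorm (ninactive P x) (grad_face P x)"
  unfolding enorm_embed[symmetric]
proof (rule enorm_mono)
  fix i assume i: "i < n"
  show "\<bar>red_grad_inactive P x i\<bar> \<le> \<bar>embed P x (grad_face P x) i\<bar>"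
    using x i red_grad_nth[OF x i] embed_grad_face[of x i]
    by (auto simp: red_grad_inactive_def Omega_iff max_def min_def)
qed

section \<open>Feasible steps and exits through the boundary of a face\<close>

text \<open>Inactive coordinates have room on both sides and the others do not move. The base point
  is any \<open>z\<close> of the face, since the lemma is needed at the end of the longest feasible
  step as well as at \<open>x\<close>.\<close>

lemma small_step_mem_Omega:
  assumes x: "x \<in> Omega P" and z: "z \<in> face P x" and c: "0 < c"
  shows "\<exists>s>0. s \<le> c \<and> z + s \<odot> embed P x d \<in> Omega P"
proof -
  have zO: "z \<in> Omega P" using z by (simp add: face_def)
  have "\<forall>\<^sub>F s in at_right 0. lower P i \<le> z i + s * embed P x d i \<and> z i + s * embed P x d i \<le> upper P i"
    if i: "i < n" for i
  proof (cases "i \<in> inactive P x")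
    case True
    have lim: "((\<lambda>s. z i + s * embed P x d i) \<longlongrightarrow> z i + 0 * embed P x d i) (at_right 0)"
      by (intro tendsto_intros)
    have "lower P i < z i + 0 * embed P x d i" "z i + 0 * embed P x d i < upper P i"
      using z True by (auto simp: face_iff[OF x])
    from order_tendstoD(1)[OF lim this(1)] order_tendstoD(2)[OF lim this(2)] show ?thesis
      by eventually_elim auto
  next
    case False
    then show ?thesis using zO i by (simp add: embed_active Omega_iff)
  qed
  then have "\<forall>\<^sub>F s in at_right 0. \<forall>i\<in>{..<n}.
      lower P i \<le> z i + s * embed P x d i \<and> z i + s * embed P x d i \<le> upper P i"
    by (intro eventually_ball_finite) auto
  moreover have "\<forall>\<^sub>F s in at_right 0. s \<in> {0<..<c}"
    using c by (rule eventually_at_right_real)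
  ultimately have "\<forall>\<^sub>F s in at_right 0. s \<in> {0<..<c} \<and> z + s \<odot> embed P x d \<in> Omega P"
    by eventually_elim
      (use zO embed_mem_Rn in \<open>auto simp: Omega_iff scale_def intro!: add_mem_Rn scale_mem_Rn[unfolded scale_def]\<close>)
  then obtain s where "s \<in> {0<..<c} \<and> z + s \<odot> embed P x d \<in> Omega P"
    using eventually_happens'[OF trivial_limit_at_right_real] by blast
  then show ?thesis by (intro exI[of _ s]) auto
qed

text \<open>\<open>GREATEST\<close> is informative only if the maximum is attained. Compactness
  gives a maximum over [0, 1] with 0 included; a small feasible step shows that it is
  positive.\<close>

lemma tmax_props:
  fixes d :: point
  assumes x: "x \<in> Omega P"
  defines "t \<equiv> tmax P x d"
  shows "0 < t" "t \<le> 1" "x + t \<odot> embed P x d \<in> Omega P"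
    "\<And>s. 0 < s \<Longrightarrow> s \<le> 1 \<Longrightarrow> x + s \<odot> embed P x d \<in> Omega P \<Longrightarrow> s \<le> t"
proof -
  let ?T = "\<lambda>t. 0 < t \<and> t \<le> 1 \<and> x + t \<odot> embed P x d \<in> Omega P"
  let ?S = "{0..1} \<inter> {t. x + t \<odot> embed P x d \<in> Omega P}"
  have "{t. x + t \<odot> embed P x d \<in> Omega P}
      = (\<Inter>i\<in>{..<n}. {t. lower P i \<le> x i + t * embed P x d i \<and> x i + t * embed P x d i \<le> upper P i})"
    using x embed_mem_Rn[of x d] nvars_pos by (auto simp: Omega_iff Rn_iff scale_def)
  also have "closed \<dots>"
    by (intro closed_INT ballI closed_Collect_conj closed_Collect_le continuous_intros)
  finally have "compact ?S" by (intro compact_Int_closed) auto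
  moreover obtain s where s: "0 < s" "s \<le> 1" "x + s \<odot> embed P x d \<in> Omega P"
    using small_step_mem_Omega[OF x self_mem_face[OF x], of 1] by auto
  ultimately obtain m where m: "m \<in> ?S" "\<And>t. t \<in> ?S \<Longrightarrow> t \<le> m"
    using compact_attains_sup[of ?S] by fastforce
  have Tm: "?T m" using m(1) m(2)[of s] s by auto
  have max: "s \<le> m" if "?T s" for s using m(2)[of s] that by auto
  have "t = m"
    unfolding t_def tmax_def using Tm max by (rule Greatest_equality)
  then show "0 < t" "t \<le> 1" "x + t \<odot> embed P x d \<in> Omega P"
    "\<And>s. 0 < s \<Longrightarrow> s \<le> 1 \<Longrightarrow> x + s \<odot> embed P x d \<in> Omega P \<Longrightarrow> s \<le> t"
    using Tm max by auto
qed

text \<open>If the end point were still in the face, the step would be less than 1 and could be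
  prolonged, against its maximality.\<close>

lemma tmax_mem_face_boundary:
  assumes x: "x \<in> Omega P" and leaves: "x + embed P x d \<notin> face P x"
  shows "x + tmax P x d \<odot> embed P x d \<in> face_boundary P x"
proof -
  let ?t = "tmax P x d"
  let ?z = "x + ?t \<odot> embed P x d"
  note t = tmax_props[OF x, where d = d]
  have "?z \<in> face_closure P x"
    using t(3) by (simp add: face_closure_iff[OF x] scale_def embed_active)
  moreover have "?z \<notin> face P x"
  proof
    assume z: "?z \<in> face P x"
    then have "?t \<noteq> 1" using leaves by auto
    then have "0 < 1 - ?t" using t by simp
    from small_step_mem_Omega[OF x z this] obtain s where
      s: "s > 0" "s \<le> 1 - ?t" "?z + s \<odot> embed P x d \<in> Omega P" by blast
    have "?z + s \<odot> embed P x d = x + (?t + s) \<odot> embed P x d"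
      by (auto simp: scale_def algebra_simps)
    with s(3) have "x + (?t + s) \<odot> embed P x d \<in> Omega P" by (simp only:)
    then have "?t + s \<le> ?t" using s t by (intro t(4)) auto
    then show False using s by simp
  qed
  ultimately show ?thesis by (simp add: face_boundary_def)
qed

text \<open>A clipped coordinate strictly between its bounds has not been changed. If the projection
  were in the face, it would equal the projected point, which is not.\<close>

lemma proj_mem_face_boundary:
  assumes x: "x \<in> Omega P" and leaves: "x + embed P x d \<notin> face P x"
  shows "proj P (x + embed P x d) \<in> face_boundary P x"
proof -
  let ?z = "x + embed P x d"
  have "proj P ?z \<in> face_closure P x"
    using x clip_mem_Omega by (auto simp: proj_eq_clip face_closure_iff clip_def embed_active Omega_iff)
  moreover have "proj P ?z \<notin> face P x"
  proof
    assume pf: "proj P ?z \<in> face P x"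
    have "proj P ?z i = ?z i" for i
    proof (cases "i \<in> inactive P x")
      case True
      then have "lower P i < proj P ?z i" "proj P ?z i < upper P i" using pf by (auto simp: face_iff[OF x])
      then show ?thesis using inactive_less[OF True] by (auto simp: proj_eq_clip clip_def max_def min_def split: if_splits)
    next
      case False
      then show ?thesis
        using x by (auto simp: proj_eq_clip clip_def embed_active Omega_iff Rn_iff)
    qed
    then have "proj P ?z = ?z" by auto
    then show False using pf leaves by simp
  qed
  ultimately show ?thesis by (simp add: face_boundary_def)
qed

end

section \<open>Step lengths\<close>

lemma backtrack_exists:
  fixes \<kappa> :: real
  assumes "0 < \<kappa>" "\<And>j. \<not> armijo r \<phi> s j \<Longrightarrow> \<kappa> < (1/2) ^ j"
  shows "\<exists>l. backtrack r \<phi> s l"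
proof -
  obtain j where "(1/2 :: real) ^ j < \<kappa>"
    using real_arch_pow_inv[OF assms(1), of "1/2"] by auto
  then have "armijo r \<phi> s j" using assms(2)[of j] by fastforce
  then have "backtrack r \<phi> s (LEAST l. armijo r \<phi> s l)"
    unfolding backtrack_def by (auto intro: LeastI dest: not_less_Least)
  then show ?thesis by blast
qed

text \<open>The premise forces \<open>\<tau>\<close> below 1/4, so the minimum is
  \<open>\<tau>\<close> for the cap 1/2 as well as for 1. The factor 4 contributes 2 to the
  logarithm, which raises the bound from \<open>l - 1\<close>, the exponent of the last failure, to
  \<open>l + 1\<close>, the number of trials.\<close>

lemma backtrack_exponent_le:
  assumes "0 < \<tau>" "4 * \<tau> < (1/2) ^ (l - 1)" "0 < l" "1/4 \<le> c"
  shows "real l + 1 \<le> \<bar>log 2 (min c \<tau>)\<bar>"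
proof -
  have "(1/2 :: real) ^ (l - 1) \<le> 1" by (rule power_le_one) auto
  then have min: "min c \<tau> = \<tau>" using assms by auto
  have "log 2 (4 * \<tau>) < log 2 ((1/2) ^ (l - 1))"
    using assms by (subst log_less_cancel_iff) auto
  moreover have "log 2 ((1/2) ^ (l - 1)) = 1 - real l"
    using assms by (simp add: log_nat_power log_divide of_nat_diff)
  moreover have "log 2 (4 * \<tau>) = 2 + log 2 \<tau>"
    using assms log_pow_cancel[of 2 2] by (simp add: log_mult)
  ultimately show ?thesis unfolding min by linarith
qed

section \<open>Constants of the decrease and of the call bound\<close>

text \<open>A step of Algorithm 2 accepted after a halving is at least this long: twice this value
  bounds the last rejected step from below. \<open>max L 1\<close> keeps it meaningful for
  \<open>L = 0\<close>.\<close>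

definition inner_step :: "alg_params \<Rightarrow> real \<Rightarrow> real" where
  "inner_step A L = (1 - rho A) * a2 A / (max L 1 * (a1 A)\<^sup>2)"

definition leave_step :: "alg_params \<Rightarrow> real \<Rightarrow> real" where
  "leave_step A L = (1 - rho A) * lam_min A / max L 1"

definition inner_decrease :: "alg_params \<Rightarrow> real \<Rightarrow> real" where
  "inner_decrease A L = rho A * a2 A * min 1 (inner_step A L) * (theta A)\<^sup>2"

text \<open>The last factor compares the projected gradient step for the spectral parameter in use
  with the reduced gradient, which is the step for parameter 1 up to sign.\<close>

definition leave_decrease :: "alg_params \<Rightarrow> real \<Rightarrow> real" where
  "leave_decrease A L = rho A * lam_min A * min 1 (leave_step A L) * (min 1 (1 / lam_max A))\<^sup>2"

definition iter_decrease :: "alg_params \<Rightarrow> real \<Rightarrow> real" where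
  "iter_decrease A L = min (inner_decrease A L) (leave_decrease A L)"

abbreviation (input) inner_log :: "alg_params \<Rightarrow> real \<Rightarrow> real" where
  "inner_log A L \<equiv> \<bar>log 2 (min (1 / 2) ((1 - rho A) * a2 A / (2 * L * (a1 A)\<^sup>2)))\<bar>"

abbreviation (input) leave_log :: "alg_params \<Rightarrow> real \<Rightarrow> real" where
  "leave_log A L \<equiv> \<bar>log 2 (min 1 ((1 - 2 * rho A) * lam_min A / (4 * L)))\<bar>"

definition call_bound :: "alg_params \<Rightarrow> real \<Rightarrow> real" where
  "call_bound A L = (real (budget A) + 5) + max (inner_log A L) (leave_log A L)"

lemma call_bound_ge: "real (budget A) + 5 \<le> call_bound A L"
  unfolding call_bound_def by simp

text \<open>With \<open>c = b / lam\<close> this is the variational inequality of the projection in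
  one coordinate, tested at \<open>a\<close>: it says \<open>v * (c + v) \<le> 0\<close>.\<close>

lemma box_step_slope:
  fixes a b l u lam :: real
  assumes "l \<le> a" "a \<le> u" "0 < lam"
  defines "v \<equiv> max l (min u (a - 1 / lam * b)) - a"
  shows "b * v \<le> - lam * v\<^sup>2"
proof -
  define c where "c = 1 / lam * b"
  have b: "b = lam * c" using assms(3) by (simp add: c_def)
  have "v * (c + v) \<le> 0"
    using assms(1,2) unfolding v_def c_def[symmetric]
    by (auto simp: mult_le_0_iff max_def min_def)
  then have "lam * (v * (c + v)) \<le> 0"
    using assms(3) by (simp add: mult_le_0_iff)
  then show ?thesis unfolding b by (simp add: algebra_simps power2_eq_square)
qed

text \<open>For \<open>b \<ge> 0\<close> both displacements have the form
  \<open>min _ (a - l)\<close>, with \<open>b\<close> and \<open>b / lam\<close> in the gap.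
  Multiplication by \<open>\<mu>\<close> brings \<open>b\<close> below \<open>b / lam\<close> and
  does not increase \<open>a - l\<close>. The other sign is symmetric, with
  \<open>u - a\<close>.\<close>

lemma box_step_scaling:
  fixes a b l u lam \<mu> :: real
  assumes "l \<le> a" "a \<le> u" "0 < lam" "0 \<le> \<mu>" "\<mu> \<le> 1" "\<mu> \<le> 1 / lam"
  shows "\<mu> * \<bar>a - max l (min u (a - b))\<bar> \<le> \<bar>max l (min u (a - 1 / lam * b)) - a\<bar>"
proof -
  define c where "c = 1 / lam * b"
  have "\<mu> * \<bar>a - max l (min u (a - b))\<bar> \<le> \<bar>max l (min u (a - c)) - a\<bar>"
  proof (cases "0 \<le> b")
    case True
    have c: "\<mu> * b \<le> c" unfolding c_def using assms True by (intro mult_right_mono) auto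
    have c0: "0 \<le> c" unfolding c_def using assms True by auto
    then have "max l (min u (a - c)) - a = - min c (a - l)"
      "a - max l (min u (a - b)) = min b (a - l)"
      using assms True by (auto simp: max_def min_def)
    moreover have "\<mu> * min b (a - l) \<le> min c (a - l)"
    proof (rule min.boundedI)
      show "\<mu> * min b (a - l) \<le> c"
        using c assms mult_left_mono[of "min b (a - l)" b \<mu>] by simp
      have "\<mu> * min b (a - l) \<le> \<mu> * (a - l)" using assms by (intro mult_left_mono) auto
      also have "\<dots> \<le> a - l" using assms by (simp add: mult_left_le_one_le)
      finally show "\<mu> * min b (a - l) \<le> a - l" .
    qed
    moreover have "0 \<le> min c (a - l)" "0 \<le> min b (a - l)" using c0 assms True by auto
    ultimately show ?thesis by (simp only: abs_minus_cancel abs_of_nonneg)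
  next
    case False
    have "\<mu> * - b \<le> 1 / lam * - b" using assms False by (intro mult_right_mono) auto
    then have c: "\<mu> * - b \<le> - c" by (simp add: c_def)
    have c0: "c \<le> 0" unfolding c_def using assms False by (intro mult_nonneg_nonpos) auto
    then have "max l (min u (a - c)) - a = min (- c) (u - a)"
      "a - max l (min u (a - b)) = - min (- b) (u - a)"
      using assms False by (auto simp: max_def min_def)
    moreover have "\<mu> * min (- b) (u - a) \<le> min (- c) (u - a)"
    proof (rule min.boundedI)
      show "\<mu> * min (- b) (u - a) \<le> - c"
        using c assms mult_left_mono[of "min (- b) (u - a)" "- b" \<mu>] by simp
      have "\<mu> * min (- b) (u - a) \<le> \<mu> * (u - a)" using assms by (intro mult_left_mono) auto
      also have "\<dots> \<le> u - a" using assms by (simp add: mult_left_le_one_le)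
      finally show "\<mu> * min (- b) (u - a) \<le> u - a" .
    qed
    moreover have "0 \<le> min (- c) (u - a)" "0 \<le> min (- b) (u - a)"
      using c0 False assms by auto
    ultimately show ?thesis by (simp only: abs_minus_cancel abs_of_nonneg)
  qed
  then show ?thesis by (simp only: c_def)
qed

section \<open>The iterations\<close>

locale box_method = smooth_box P L for P :: box_problem and L :: real +
  fixes A :: alg_params
  assumes theta_pos: "0 < theta A"
    and rho_pos: "0 < rho A" and rho_less: "rho A < 1 / 2"
    and a1_ge: "1 \<le> a1 A"
    and a2_pos: "0 < a2 A" and a2_less: "a2 A < 1"
    and lam_min_pos: "0 < lam_min A" and lam_min_le: "lam_min A \<le> lam_max A"
begin

text \<open>The norm bound holds because the direction is a convex combination of \<open>d2\<close>
  and the negative gradient, both of norm at most \<open>a1 A\<close> times the gradient norm; for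
  the latter this uses \<open>1 \<le> a1 A\<close>.\<close>

lemma search_dir_props:
  assumes g: "0 < enorm (ninactive P x) (grad_face P x)"
  shows "einner (ninactive P x) (grad_face P x) (search_dir A P x d1)
      \<le> - a2 A * (enorm (ninactive P x) (grad_face P x))\<^sup>2" (is ?slope)
    and "enorm (ninactive P x) (search_dir A P x d1)
      \<le> a1 A * enorm (ninactive P x) (grad_face P x)" (is ?norm)
proof -
  define k where "k = ninactive P x"
  define g where "g = grad_face P x"
  define G where "G = enorm k g"
  define d2 where "d2 = scaled_dir A P x d1"
  define s where "s = einner k g d2"
  have G: "0 < G" using assms by (simp add: G_def k_def g_def)
  have d2: "enorm k d2 \<le> a1 A * G"
  proof -
    have "0 < a1 A * G" using G a1_ge by simp
    then show ?thesis
      by (auto simp: d2_def scaled_dir_def Let_def enorm_scale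
          simp flip: k_def g_def G_def)
  qed
  define b where "b = (1 - a2 A) / (1 + s / G\<^sup>2)"
  have d: "search_dir A P x d1 =
      (let \<beta> = (if s \<le> - a2 A * G\<^sup>2 then 1 else b) in \<beta> \<odot> d2 + (1 - \<beta>) \<odot> (- g))"
    by (simp add: search_dir_def Let_def s_def d2_def k_def g_def G_def b_def)
  have "einner k g (search_dir A P x d1) \<le> - a2 A * G\<^sup>2 \<and> enorm k (search_dir A P x d1) \<le> a1 A * G"
  proof (cases "s \<le> - a2 A * G\<^sup>2")
    case True
    then have "search_dir A P x d1 = d2" by (simp add: d scale_def plus_fun_def)
    then show ?thesis using True d2 by (simp add: s_def)
  next
    case False
    then have "- a2 A < s / G\<^sup>2" using G by (simp add: pos_less_divide_eq)
    then have den: "1 - a2 A < 1 + s / G\<^sup>2" by simp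
    then have b: "0 < b" "b < 1" using a2_less by (auto simp: b_def pos_divide_less_eq)
    have d': "search_dir A P x d1 = b \<odot> d2 + (1 - b) \<odot> (- g)"
      using False by (simp add: d Let_def)
    \<comment> \<open>This identity explains the formula for the weight: it makes the slope exactly
      \<open>- a2 A * G\<^sup>2\<close>.\<close>
    have b_den: "b * (1 + s / G\<^sup>2) = 1 - a2 A" using den a2_less by (simp add: b_def)
    have "einner k g (search_dir A P x d1) = b * s - (1 - b) * G\<^sup>2"
      by (simp add: d' einner_add_right einner_scale_right einner_uminus_right einner_self s_def G_def)
    also have "\<dots> = b * (s + G\<^sup>2) - G\<^sup>2"
      by (simp only: distrib_left left_diff_distrib)
    also have "s + G\<^sup>2 = (1 + s / G\<^sup>2) * G\<^sup>2"
      using G by (simp add: distrib_right)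
    also have "b * ((1 + s / G\<^sup>2) * G\<^sup>2) = (1 - a2 A) * G\<^sup>2"
      by (simp only: b_den flip: mult.assoc)
    also have "(1 - a2 A) * G\<^sup>2 - G\<^sup>2 = - a2 A * G\<^sup>2"
      by (simp add: algebra_simps)
    finally have "einner k g (search_dir A P x d1) \<le> - a2 A * G\<^sup>2" by simp
    moreover have "enorm k (search_dir A P x d1) \<le> b * enorm k d2 + (1 - b) * G"
      unfolding d' using b enorm_add_le[of k "b \<odot> d2" "(1 - b) \<odot> (- g)"]
      by (simp add: enorm_scale G_def)
    moreover have "b * enorm k d2 \<le> b * (a1 A * G)"
      using b d2 by (intro mult_left_mono) auto
    moreover have "(1 - b) * G \<le> (1 - b) * (a1 A * G)"
      using b G a1_ge by (intro mult_left_mono) auto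
    ultimately show ?thesis by (simp add: algebra_simps)
  qed
  then show ?slope ?norm by (simp_all add: k_def g_def G_def)
qed

lemma inner_step_pos: "0 < inner_step A L"
  using rho_less a2_pos a1_ge by (simp add: inner_step_def)

lemma leave_step_pos: "0 < leave_step A L"
  using rho_less lam_min_pos by (simp add: leave_step_def)

lemma iter_decrease_pos: "0 < iter_decrease A L"
proof -
  have "0 < min 1 (1 / lam_max A)" using lam_min_pos lam_min_le by simp
  then show ?thesis
    using rho_pos a2_pos theta_pos lam_min_pos inner_step_pos leave_step_pos
    unfolding iter_decrease_def inner_decrease_def leave_decrease_def
    by (intro min_less_iff_conj[THEN iffD2] conjI mult_pos_pos zero_less_power) auto
qed

text \<open>The second bound, with \<open>L\<close> itself and with \<open>\<alpha>\<close> absorbed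
  by \<open>\<alpha> \<le> 1\<close>, serves the count of trials. The third keeps
  \<open>\<alpha>\<close>, since the decrease depends on the step actually taken.\<close>

lemma inner_armijo_fails:
  assumes x: "x \<in> Omega P" and \<alpha>: "0 < \<alpha>" "\<alpha> \<le> 1"
    and g: "0 < enorm (ninactive P x) (grad_face P x)"
    and d: "d = search_dir A P x d1"
    and fails: "\<not> armijo (rho A) (\<lambda>t. obj_face P x ((t * \<alpha>) \<odot> d))
        (\<alpha> * einner (ninactive P x) (grad_face P x) d) j"
  shows "0 < L" "2 * (1 - rho A) * a2 A / (L * (a1 A)\<^sup>2) < (1/2) ^ j"
    "2 * inner_step A L < (1/2) ^ j * \<alpha>"
proof -
  let ?G = "enorm (ninactive P x) (grad_face P x)" and ?D = "embed P x d"
  let ?t = "(1/2) ^ j * \<alpha>"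
  have xR: "x \<in> Rn n" using x by (rule Omega_subset_Rn)
  have sl: "einner n (grad P x) ?D \<le> - a2 A * ?G\<^sup>2" and nm: "enorm n ?D \<le> a1 A * ?G"
    using search_dir_props[OF g, of d1] xR by (simp_all add: einner_embed enorm_embed d)
  have "\<not> armijo (rho A) (\<lambda>t. f (x + (t * \<alpha>) \<odot> ?D)) (\<alpha> * einner n (grad P x) ?D) j"
    using fails xR by (simp add: einner_embed obj_face_eq embed_scale)
  from armijo_fails[OF xR embed_mem_Rn \<alpha>(1) this]
  have fail: "2 * (1 - rho A) * - einner n (grad P x) ?D < L * ?t * (enorm n ?D)\<^sup>2" .
  have "2 * (1 - rho A) * (a2 A * ?G\<^sup>2) \<le> 2 * (1 - rho A) * - einner n (grad P x) ?D"
    using sl rho_less by (intro mult_left_mono) auto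
  also note fail
  also have "L * ?t * (enorm n ?D)\<^sup>2 \<le> L * ?t * (a1 A * ?G)\<^sup>2"
    using nm L_nonneg \<alpha> by (intro mult_left_mono power_mono) auto
  finally have "2 * (1 - rho A) * a2 A * ?G\<^sup>2 < L * ?t * (a1 A)\<^sup>2 * ?G\<^sup>2"
    by (simp add: power_mult_distrib mult_ac)
  then have key: "2 * (1 - rho A) * a2 A < L * ?t * (a1 A)\<^sup>2"
    using g by simp
  show L: "0 < L"
  proof (rule ccontr)
    assume "\<not> 0 < L"
    then have "L = 0" using L_nonneg by simp
    then have "2 * (1 - rho A) * a2 A < 0" using key by (simp only: mult_zero_left)
    moreover have "0 < 2 * (1 - rho A) * a2 A"
      using rho_less a2_pos by (intro mult_pos_pos) auto
    ultimately show False by simp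
  qed
  have a1: "0 < a1 A" using a1_ge by simp
  have "2 * (1 - rho A) * a2 A / (L * (a1 A)\<^sup>2) < ?t"
    using key L a1 by (simp add: pos_divide_less_eq mult_ac)
  also have "?t \<le> (1/2) ^ j" using \<alpha> by (simp add: mult_left_le)
  finally show "2 * (1 - rho A) * a2 A / (L * (a1 A)\<^sup>2) < (1/2) ^ j" .
  have "L * ?t * (a1 A)\<^sup>2 \<le> max L 1 * ?t * (a1 A)\<^sup>2"
    using \<alpha> by (intro mult_right_mono) auto
  then have "2 * (1 - rho A) * a2 A < max L 1 * ?t * (a1 A)\<^sup>2"
    by (rule less_le_trans[OF key])
  moreover have "0 < max L 1 * (a1 A)\<^sup>2" using a1 by simp
  ultimately have "2 * (1 - rho A) * a2 A / (max L 1 * (a1 A)\<^sup>2) < ?t"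
    by (subst pos_divide_less_eq) (simp_all add: mult_ac)
  then show "2 * inner_step A L < ?t"
    by (simp only: inner_step_def times_divide_eq_right mult.assoc)
qed

text \<open>After a halving the decrease does not depend on \<open>\<alpha>\<close>. Without one it
  is proportional to \<open>\<alpha>\<close>; the value at the first trial point is then recorded
  too, so that Step 2.3 can exclude this alternative.\<close>

lemma alg2_search_outcome:
  assumes x: "x \<in> Omega P" and \<alpha>: "0 < \<alpha>" "\<alpha> \<le> 1"
    and inside: "x + \<alpha> \<odot> embed P x d \<in> Omega P"
    and g: "0 < enorm (ninactive P x) (grad_face P x)"
    and d: "d = search_dir A P x d1"
    and run: "alg2_search A P x d \<alpha> qs y"
  shows "y \<in> Omega P \<and>
    (real (length qs) \<le> inner_log A L \<and>
      f y \<le> f x - rho A * a2 A * inner_step A L * (enorm (ninactive P x) (grad_face P x))\<^sup>2 \<or>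
     length qs \<le> Suc (budget A) \<and>
      f y \<le> f (x + \<alpha> \<odot> embed P x d) \<and>
      f (x + \<alpha> \<odot> embed P x d) \<le> f x - rho A * a2 A * \<alpha> * (enorm (ninactive P x) (grad_face P x))\<^sup>2)"
  using run
proof cases
  case (positive l)
  let ?G = "enorm (ninactive P x) (grad_face P x)"
  let ?s = "einner (ninactive P x) (grad_face P x) d"
  let ?t = "(1/2) ^ l * \<alpha>"
  have "\<not> armijo (rho A) (\<lambda>t. obj_face P x ((t * \<alpha>) \<odot> d)) (\<alpha> * ?s) (l - 1)"
    using positive by (simp add: backtrack_def)
  note fails = inner_armijo_fails[OF x \<alpha> g d this]
  have \<tau>: "4 * ((1 - rho A) * a2 A / (2 * L * (a1 A)\<^sup>2)) = 2 * (1 - rho A) * a2 A / (L * (a1 A)\<^sup>2)"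
    using fails(1) a1_ge by (simp add: field_simps)
  have "real l + 1 \<le> inner_log A L"
  proof (rule backtrack_exponent_le[OF _ fails(2)[folded \<tau>]])
    show "0 < (1 - rho A) * a2 A / (2 * L * (a1 A)\<^sup>2)"
      using fails(1) rho_less a2_pos a1_ge by simp
  qed (use positive in simp_all)
  then have len: "real (length qs) \<le> inner_log A L"
    using positive by (simp add: trials_def)
  have "(1/2 :: real) ^ (l - 1) = 2 * (1/2) ^ l"
    using positive by (cases l) auto
  then have t: "inner_step A L \<le> ?t" using fails(3) by simp
  have "f y \<le> f x + rho A * ?t * ?s"
    using positive by (simp add: backtrack_def armijo_def obj_face_eq obj_face_zero embed_scale mult_ac)
  also have "\<dots> \<le> f x + rho A * ?t * (- a2 A * ?G\<^sup>2)"
    using search_dir_props(1)[OF g, of d1] rho_pos \<alpha> unfolding d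
    by (intro add_left_mono mult_left_mono) auto
  also have "\<dots> \<le> f x - rho A * a2 A * inner_step A L * ?G\<^sup>2"
    using mult_left_mono[OF t, of "rho A * a2 A * ?G\<^sup>2"] rho_pos a2_pos by (simp add: mult_ac)
  finally have dec: "f y \<le> f x - rho A * a2 A * inner_step A L * ?G\<^sup>2" .
  have "y = x + (1/2) ^ l \<odot> (\<alpha> \<odot> embed P x d)"
    using positive by (simp add: scale_scale)
  then have "y \<in> Omega P"
    using Omega_convex_step[OF x inside, of "(1/2) ^ l"] by (simp add: power_le_one)
  then show ?thesis using len dec by blast
next
  case (zero es)
  let ?G = "enorm (ninactive P x) (grad_face P x)"
  let ?s = "einner (ninactive P x) (grad_face P x) d"
  have "f (x + \<alpha> \<odot> embed P x d) \<le> f x + rho A * \<alpha> * ?s"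
    using zero by (simp add: backtrack_def armijo_def obj_face_eq obj_face_zero embed_scale mult_ac)
  also have "\<dots> \<le> f x + rho A * \<alpha> * (- a2 A * ?G\<^sup>2)"
    using search_dir_props(1)[OF g, of d1] rho_pos \<alpha> unfolding d
    by (intro add_left_mono mult_left_mono) auto
  finally have "f (x + \<alpha> \<odot> embed P x d) \<le> f x - rho A * a2 A * \<alpha> * ?G\<^sup>2"
    by (simp add: mult_ac)
  moreover have "y \<in> Omega P" using zero x by (simp add: face_closure_iff)
  moreover have "length qs \<le> Suc (budget A)" using zero by (simp add: trials_def)
  moreover have "f y \<le> f (x + \<alpha> \<odot> embed P x d)"
    using zero by (simp add: obj_face_eq embed_scale)
  ultimately show ?thesis by blast
qed

lemma alg2_search_exists:
  assumes x: "x \<in> Omega P" and \<alpha>: "0 < \<alpha>" "\<alpha> \<le> 1"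
    and inside: "x + \<alpha> \<odot> embed P x d \<in> Omega P"
    and g: "0 < enorm (ninactive P x) (grad_face P x)"
    and d: "d = search_dir A P x d1"
  shows "\<exists>qs y. alg2_search A P x d \<alpha> qs y"
proof -
  let ?\<phi> = "\<lambda>t. obj_face P x ((t * \<alpha>) \<odot> d)"
  let ?s = "\<alpha> * einner (ninactive P x) (grad_face P x) d"
  have "\<exists>l. backtrack (rho A) ?\<phi> ?s l"
  proof (rule backtrack_exists[OF inner_step_pos])
    fix j assume "\<not> armijo (rho A) ?\<phi> ?s j"
    from inner_armijo_fails(3)[OF x \<alpha> g d this]
    have "2 * inner_step A L < (1/2) ^ j * \<alpha>" .
    also have "\<dots> \<le> (1/2) ^ j" using \<alpha> by (simp add: mult_left_le)
    finally show "inner_step A L < (1/2) ^ j" using inner_step_pos by simp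
  qed
  then obtain l where l: "backtrack (rho A) ?\<phi> ?s l" ..
  show ?thesis
  proof (cases "l = 0")
    case True
    \<comment> \<open>Step 4 may return the accepted trial point itself and spend no further
      calls.\<close>
    have "x + \<alpha> \<odot> embed P x d \<in> face_closure P x"
      using inside x by (simp add: face_closure_iff embed_active scale_def)
    then show ?thesis
      using alg2_search.zero[of A P x \<alpha> d "[]" "x + \<alpha> \<odot> embed P x d"] l True
      by (auto simp: obj_face_eq embed_scale)
  next
    case False
    then show ?thesis using alg2_search.positive[OF l] by blast
  qed
qed

text \<open>The second alternative covers moves to the boundary of the face, where the objective
  need not drop at all.\<close>

definition progress :: "real \<Rightarrow> point \<Rightarrow> point \<Rightarrow> bool" where
  "progress \<delta> x y \<longleftrightarrow> f y \<le> f x - \<delta> \<or> f y \<le> f x \<and> ninactive P y < ninactive P x"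

text \<open>The added 1 reserves room for the gradient call of the stopping test, which is charged
  outside Algorithm 2.\<close>

lemma alg2_outcome:
  assumes x: "x \<in> Omega P" and g: "0 < enorm (ninactive P x) (grad_face P x)"
    and run: "alg2 A P d1 x qs y"
  shows "y \<in> Omega P \<and> real (length qs) + 1 \<le> call_bound A L \<and>
    progress (rho A * a2 A * min 1 (inner_step A L) * (enorm (ninactive P x) (grad_face P x))\<^sup>2) x y"
proof -
  let ?G = "enorm (ninactive P x) (grad_face P x)"
  have cb: "real (budget A) + 5 \<le> call_bound A L" "inner_log A L + 5 \<le> call_bound A L"
    unfolding call_bound_def by auto
  have dec: "progress (rho A * a2 A * min 1 (inner_step A L) * ?G\<^sup>2) x y"
    if "f y \<le> f x - rho A * a2 A * c * ?G\<^sup>2" "min 1 (inner_step A L) \<le> c" for c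
  proof -
    have "rho A * a2 A * min 1 (inner_step A L) * ?G\<^sup>2 \<le> rho A * a2 A * c * ?G\<^sup>2"
      using that rho_pos a2_pos by (intro mult_right_mono mult_left_mono) auto
    then show ?thesis using that by (simp add: progress_def)
  qed
  show ?thesis
    using run
  proof cases
    case (step2_1 d qs')
    have inside: "x + 1 \<odot> embed P x d \<in> Omega P"
      using step2_1 by (simp add: face_def)
    \<comment> \<open>The initial step is 1 here, so an accepted first trial also gives a uniform
      decrease; hence the factor \<open>min 1 (inner_step A L)\<close>.\<close>
    from alg2_search_outcome[OF x _ _ inside g step2_1(2) step2_1(4)]
    show ?thesis
      using cb step2_1 dec[of 1] dec[of "inner_step A L"] by auto
  next
    case (step2_2 d p es)
    then show ?thesis
      using ninactive_face_boundary_less[OF x] cb by (auto simp: progress_def obj_face_zero)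
  next
    case (step2_3_stop d p t es)
    then show ?thesis
      using ninactive_face_boundary_less[OF x] cb by (auto simp: progress_def obj_face_zero)
  next
    case (step2_3_continue d p t qs')
    note tm = tmax_props(1-3)[OF x, where d = d, folded step2_3_continue(6)]
    \<comment> \<open>This contradicts the alternative of \<open>alg2_search_outcome\<close> in
      which the first trial is accepted, so neither the \<open>m\<close> calls nor a decrease
      proportional to \<open>t\<close> can occur.\<close>
    have "f x < f (x + t \<odot> embed P x d)"
      using step2_3_continue(7) unfolding obj_face_zero by (simp add: obj_face_eq embed_scale)
    moreover have "0 \<le> rho A * a2 A * t * ?G\<^sup>2" using rho_pos a2_pos tm by simp
    ultimately show ?thesis
      using alg2_search_outcome[OF x tm g step2_3_continue(2) step2_3_continue(8)]
        cb step2_3_continue(1) dec[of "inner_step A L"] by auto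
  qed
qed

lemma alg2_exists:
  assumes x: "x \<in> Omega P" and g: "0 < enorm (ninactive P x) (grad_face P x)"
  shows "\<exists>qs y. alg2 A P d1 x qs y"
proof -
  define d where "d = search_dir A P x d1"
  define t where "t = tmax P x d"
  let ?z = "x + embed P x d"
  show ?thesis
  proof (cases "?z \<in> face P x")
    case True
    then have "x + 1 \<odot> embed P x d \<in> Omega P" by (simp add: face_def)
    from alg2_search_exists[OF x _ _ this g d_def] show ?thesis
      using alg2.step2_1[OF d_def True] by auto
  next
    case leaves: False
    show ?thesis
    proof (cases "f (proj P ?z) \<le> obj_face P x 0")
      case True
      then show ?thesis
        using alg2.step2_2[OF d_def leaves refl, of "[]" "proj P ?z"]
          proj_mem_face_boundary[OF x leaves] by auto
    next
      case worse: False
      show ?thesis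
      proof (cases "obj_face P x (t \<odot> d) \<le> obj_face P x 0")
        case True
        then show ?thesis
          using alg2.step2_3_stop[OF d_def leaves refl worse t_def True, of "[]" "x + t \<odot> embed P x d"]
            tmax_mem_face_boundary[OF x leaves] by (auto simp: t_def obj_face_eq embed_scale)
      next
        case False
        note tm = tmax_props(1-3)[OF x, where d = d, folded t_def]
        show ?thesis
          using alg2.step2_3_continue[OF d_def leaves refl worse t_def False]
            alg2_search_exists[OF x tm g d_def] by blast
      qed
    qed
  qed
qed

section \<open>The projected gradient step of Algorithm 3\<close>

lemma spg_step_props:
  assumes x: "x \<in> Omega P" and lam: "lam \<in> {lam_min A..lam_max A}"
    and v: "v = proj P (x - (1 / lam) \<odot> grad P x) - x"
  shows "v \<in> Rn n" "x + v \<in> Omega P"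
    "einner n (grad P x) v \<le> - lam * (enorm n v)\<^sup>2"
    "min 1 (1 / lam_max A) * enorm n (red_grad P x) \<le> enorm n v"
proof -
  have lam0: "0 < lam" using lam lam_min_pos by simp
  have "x + v = clip P (x - (1 / lam) \<odot> grad P x)"
    by (simp add: v proj_eq_clip)
  then show xv: "x + v \<in> Omega P" using clip_mem_Omega by simp
  show "v \<in> Rn n" using xv x by (auto simp: Omega_iff Rn_iff)
  have vi: "v i = max (lower P i) (min (upper P i) (x i - 1 / lam * grad P x i)) - x i" if "i < n" for i
    using that by (simp add: v proj_eq_clip clip_def scale_def)
  have "einner n (grad P x) v \<le> (\<Sum>i<n. - lam * (v i)\<^sup>2)"
    unfolding einner_def
  proof (rule sum_mono)
    fix i assume "i \<in> {..<n}"
    then show "grad P x i * v i \<le> - lam * (v i)\<^sup>2"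
      using x vi[of i] box_step_slope[OF _ _ lam0] by (auto simp: Omega_iff)
  qed
  then show "einner n (grad P x) v \<le> - lam * (enorm n v)\<^sup>2"
    by (simp add: enorm_sq sum_distrib_left)
  let ?\<mu> = "min 1 (1 / lam_max A)"
  have \<mu>: "0 \<le> ?\<mu>" "?\<mu> \<le> 1" "?\<mu> \<le> 1 / lam"
    using lam lam0 by (auto simp: min.coboundedI2 frac_le)
  have "?\<mu> * enorm n (red_grad P x) = enorm n (?\<mu> \<odot> red_grad P x)"
    using \<mu> by (simp add: enorm_scale)
  also have "\<dots> \<le> enorm n v"
  proof (rule enorm_mono)
    fix i assume i: "i < n"
    then have "lower P i \<le> x i" "x i \<le> upper P i" using x by (auto simp: Omega_iff)
    from box_step_scaling[OF this lam0 \<mu>, of "grad P x i"]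
    show "\<bar>(?\<mu> \<odot> red_grad P x) i\<bar> \<le> \<bar>v i\<bar>"
      using \<mu>(1) by (simp add: scale_def abs_mult red_grad_nth[OF x i] vi[OF i])
  qed
  finally show "?\<mu> * enorm n (red_grad P x) \<le> enorm n v" .
qed

lemma leave_armijo_fails:
  assumes x: "x \<in> Omega P" and lam: "lam \<in> {lam_min A..lam_max A}"
    and v: "v = proj P (x - (1 / lam) \<odot> grad P x) - x"
    and fails: "\<not> armijo (rho A) (\<lambda>t. f (x + t \<odot> v)) (einner n (grad P x) v) j"
  shows "0 < L" "2 * (1 - rho A) * lam_min A / L < (1/2) ^ j" "2 * leave_step A L < (1/2) ^ j"
proof -
  note p = spg_step_props[OF x lam v]
  let ?t = "(1/2 :: real) ^ j"
  have "2 * (1 - rho A) * (lam * (enorm n v)\<^sup>2) \<le> 2 * (1 - rho A) * - einner n (grad P x) v"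
    using p(3) rho_less by (intro mult_left_mono) auto
  also have "\<dots> < L * ?t * (enorm n v)\<^sup>2"
    using armijo_fails[OF Omega_subset_Rn[OF x] p(1), of 1] fails by simp
  finally have less: "2 * (1 - rho A) * lam * (enorm n v)\<^sup>2 < L * ?t * (enorm n v)\<^sup>2"
    by (simp only: mult.assoc)
  \<comment> \<open>A strict inequality between two multiples of the squared norm excludes
    \<open>v = 0\<close>, so the norm can be cancelled.\<close>
  then have "enorm n v \<noteq> 0" by auto
  then have "2 * (1 - rho A) * lam < L * ?t"
    using less by (simp add: zero_less_power2 mult_less_cancel_right_pos)
  moreover have "2 * (1 - rho A) * lam_min A \<le> 2 * (1 - rho A) * lam"
    using lam rho_less by (intro mult_left_mono) auto
  ultimately have key: "2 * (1 - rho A) * lam_min A < L * ?t" by linarith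
  show L: "0 < L"
  proof (rule ccontr)
    assume "\<not> 0 < L"
    then have "L = 0" using L_nonneg by simp
    then have "2 * (1 - rho A) * lam_min A < 0" using key by (simp only: mult_zero_left)
    moreover have "0 < 2 * (1 - rho A) * lam_min A"
      using rho_less lam_min_pos by (intro mult_pos_pos) auto
    ultimately show False by simp
  qed
  show "2 * (1 - rho A) * lam_min A / L < ?t"
    using key L by (simp add: pos_divide_less_eq mult_ac)
  have "L * ?t \<le> max L 1 * ?t" by (intro mult_right_mono) auto
  then have "2 * (1 - rho A) * lam_min A < max L 1 * ?t"
    by (rule less_le_trans[OF key])
  moreover have "0 < max L 1" by simp
  ultimately have "2 * (1 - rho A) * lam_min A / max L 1 < ?t"
    by (subst pos_divide_less_eq) (simp_all add: mult_ac)
  then show "2 * leave_step A L < ?t"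
    by (simp only: leave_step_def times_divide_eq_right mult.assoc)
qed

lemma alg3_outcome:
  assumes x: "x \<in> Omega P" and lam: "lam \<in> {lam_min A..lam_max A}"
    and run: "alg3 A P lam x qs y"
  shows "y \<in> Omega P \<and> real (length qs) + 1 \<le> call_bound A L \<and>
    f y \<le> f x - leave_decrease A L * (enorm n (red_grad P x))\<^sup>2"
  using run
proof cases
  case (1 v j)
  note p = spg_step_props[OF x lam 1(3)]
  have yO: "y \<in> Omega P"
    unfolding 1(2) using Omega_convex_step[OF x p(2), of "(1/2) ^ j"] by (simp add: power_le_one)
  have bt: "\<not> armijo (rho A) (\<lambda>t. f (x + t \<odot> v)) (einner n (grad P x) v) (j - 1)" if "0 < j"
    using 1(4) that by (simp add: backtrack_def)
  have len: "real j + 3 \<le> call_bound A L"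
  proof (cases "j = 0")
    case True
    then show ?thesis using call_bound_ge[of A L] by simp
  next
    case False
    note fails = leave_armijo_fails[OF x lam 1(3) bt]
    \<comment> \<open>The logarithm contains \<open>1 - 2 * rho A\<close>, whereas a failed test
      yields the larger factor \<open>2 * (1 - rho A)\<close>.\<close>
    have "4 * ((1 - 2 * rho A) * lam_min A / (4 * L)) \<le> 2 * (1 - rho A) * lam_min A / L"
      using fails(1) False lam_min_pos rho_pos by (simp add: divide_right_mono)
    then have \<sigma>: "4 * ((1 - 2 * rho A) * lam_min A / (4 * L)) < (1/2) ^ (j - 1)"
      using fails(2) False by linarith
    have "real j + 1 \<le> leave_log A L"
    proof (rule backtrack_exponent_le[OF _ \<sigma>])
      show "0 < (1 - 2 * rho A) * lam_min A / (4 * L)"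
        using fails(1) False rho_less lam_min_pos by simp
    qed (use False in simp_all)
    then show ?thesis unfolding call_bound_def by linarith
  qed
  have t: "min 1 (leave_step A L) \<le> (1/2) ^ j"
  proof (cases j)
    case 0
    then show ?thesis by simp
  next
    case (Suc i)
    then show ?thesis using leave_armijo_fails(3)[OF x lam 1(3) bt] by simp
  qed
  let ?\<mu> = "min 1 (1 / lam_max A)"
  have "leave_decrease A L * (enorm n (red_grad P x))\<^sup>2
      = (rho A * lam_min A) * (min 1 (leave_step A L) * (?\<mu> * enorm n (red_grad P x))\<^sup>2)"
    by (simp add: leave_decrease_def power_mult_distrib mult_ac)
  also have "\<dots> \<le> (rho A * lam) * ((1/2) ^ j * (enorm n v)\<^sup>2)"
    using t p(4) lam rho_pos lam_min_pos leave_step_pos lam_min_le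
    by (intro mult_mono power_mono) auto
  also have "\<dots> \<le> - (rho A * (1/2) ^ j * einner n (grad P x) v)"
    using mult_left_mono[OF p(3), of "rho A * (1/2) ^ j"] rho_pos by (simp add: mult_ac)
  finally have "f y \<le> f x - leave_decrease A L * (enorm n (red_grad P x))\<^sup>2"
    using 1(2,4) by (simp add: backtrack_def armijo_def)
  then show ?thesis using yO len 1(1) by (simp add: trials_def)
qed

lemma alg3_exists:
  assumes x: "x \<in> Omega P" and lam: "lam \<in> {lam_min A..lam_max A}"
  shows "\<exists>qs y. alg3 A P lam x qs y"
proof -
  define v where "v = proj P (x - (1 / lam) \<odot> grad P x) - x"
  have "\<exists>l. backtrack (rho A) (\<lambda>t. f (x + t \<odot> v)) (einner n (grad P x) v) l"
  proof (rule backtrack_exists[OF leave_step_pos])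
    fix j assume "\<not> armijo (rho A) (\<lambda>t. f (x + t \<odot> v)) (einner n (grad P x) v) j"
    from leave_armijo_fails(3)[OF x lam v_def this]
    show "leave_step A L < (1/2) ^ j" using leave_step_pos by simp
  qed
  then show ?thesis using alg3.intros[OF v_def] by blast
qed

text \<open>Positivity matters because the analysis of \<open>search_dir\<close> divides by the
  squared norm of the face gradient.\<close>

lemma inner_grad_face_ge:
  assumes x: "x \<in> Omega P" and eps: "0 < eps" "\<not> enorm n (red_grad P x) \<le> eps"
    and inner: "theta A * enorm n (red_grad P x) \<le> enorm n (red_grad_inactive P x)"
  shows "theta A * eps \<le> enorm (ninactive P x) (grad_face P x)"
    "0 < enorm (ninactive P x) (grad_face P x)"
proof -
  have "theta A * eps \<le> theta A * enorm n (red_grad P x)"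
    using eps theta_pos by (intro mult_left_mono) auto
  also note inner
  also note enorm_red_grad_inactive_le[OF x]
  finally show *: "theta A * eps \<le> enorm (ninactive P x) (grad_face P x)" .
  have "0 < theta A * eps" using eps theta_pos by simp
  then show "0 < enorm (ninactive P x) (grad_face P x)" using * by linarith
qed

lemma alg1_iter_outcome:
  assumes x: "x \<in> Omega P" and lam: "lam \<in> {lam_min A..lam_max A}" and eps: "0 < eps"
    and run: "alg1_iter A P eps d1 lam x qs r"
  shows "real (length qs) \<le> call_bound A L \<and>
    (case r of None \<Rightarrow> enorm n (red_grad P x) \<le> eps
     | Some y \<Rightarrow> y \<in> Omega P \<and> progress (iter_decrease A L * eps\<^sup>2) x y)"
  using run
proof cases
  case stop
  then show ?thesis using call_bound_ge[of A L] by simp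
next
  case (inner qs' y)
  let ?G = "enorm (ninactive P x) (grad_face P x)"
  note G = inner_grad_face_ge[OF x eps inner(3,4)]
  have "iter_decrease A L * eps\<^sup>2 \<le> inner_decrease A L * eps\<^sup>2"
    by (simp add: iter_decrease_def mult_right_mono)
  also have "\<dots> = rho A * a2 A * min 1 (inner_step A L) * (theta A * eps)\<^sup>2"
    by (simp add: inner_decrease_def power_mult_distrib)
  also have "\<dots> \<le> rho A * a2 A * min 1 (inner_step A L) * ?G\<^sup>2"
    using G(1) eps theta_pos rho_pos a2_pos inner_step_pos
    by (intro mult_left_mono power_mono) auto
  finally show ?thesis
    using alg2_outcome[OF x G(2) inner(5)] inner(1,2) by (auto simp: progress_def)
next
  case (leave qs' y)
  have "0 \<le> leave_decrease A L" using iter_decrease_pos by (simp add: iter_decrease_def)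
  then have "iter_decrease A L * eps\<^sup>2 \<le> leave_decrease A L * (enorm n (red_grad P x))\<^sup>2"
    using eps leave(3) by (intro mult_mono power_mono) (auto simp: iter_decrease_def)
  then show ?thesis
    using alg3_outcome[OF x lam leave(5)] leave(1,2) by (auto simp: progress_def)
qed

lemma alg1_iter_exists:
  assumes x: "x \<in> Omega P" and lam: "lam \<in> {lam_min A..lam_max A}" and eps: "0 < eps"
  shows "\<exists>qs r. alg1_iter A P eps d1 lam x qs r"
proof (cases "enorm n (red_grad P x) \<le> eps")
  case True
  then show ?thesis using alg1_iter.stop by blast
next
  case False
  show ?thesis
  proof (cases "theta A * enorm n (red_grad P x) \<le> enorm n (red_grad_inactive P x)")
    case True
    then show ?thesis
      using alg2_exists[OF x inner_grad_face_ge(2)[OF x eps False True], of d1]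
        alg1_iter.inner[OF False True] by blast
  next
    case inner: False
    then show ?thesis
      using alg3_exists[OF x lam] alg1_iter.leave[OF False inner] by blast
  qed
qed

section \<open>Complexity\<close>

lemma alg1_run_Some:
  assumes run: "alg1_run A P eps x0 xs qs N" and k: "k < N" and xk: "xs k = Some x"
  shows "\<exists>d1. \<exists>lam\<in>{lam_min A..lam_max A}. alg1_iter A P eps d1 lam x (qs k) (xs (Suc k))"
  using run k xk unfolding alg1_run_def
  by (auto dest!: spec[of _ k]) (meson atLeastAtMost_iff)

lemma alg1_run_None:
  assumes "alg1_run A P eps x0 xs qs N" "k < N" "xs k = None"
  shows "qs k = []" "xs (Suc k) = None"
  using assms unfolding alg1_run_def by (auto dest!: spec[of _ k])

lemma alg1_run_mem_Omega:
  assumes run: "alg1_run A P eps x0 xs qs N" and x0: "x0 \<in> Omega P" and eps: "0 < eps"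
  shows "k \<le> N \<Longrightarrow> xs k = Some x \<Longrightarrow> x \<in> Omega P"
proof (induction k arbitrary: x)
  case 0
  then show ?case using run x0 by (simp add: alg1_run_def)
next
  case (Suc k)
  show ?case
  proof (cases "xs k")
    case None
    then show ?thesis using alg1_run_None[OF run, of k] Suc.prems by simp
  next
    case (Some y)
    then have y: "y \<in> Omega P" using Suc by simp
    obtain d1 lam where "lam \<in> {lam_min A..lam_max A}" "alg1_iter A P eps d1 lam y (qs k) (xs (Suc k))"
      using alg1_run_Some[OF run _ Some] Suc.prems by (auto simp only: Suc_le_eq)
    from alg1_iter_outcome[OF y this(1) eps this(2)] show ?thesis using Suc.prems by simp
  qed
qed

lemma alg1_run_calls_le:
  assumes run: "alg1_run A P eps x0 xs qs N" and x0: "x0 \<in> Omega P" and eps: "0 < eps" and k: "k < N"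
  shows "real (length (qs k)) \<le> call_bound A L"
proof (cases "xs k")
  case None
  then have "qs k = []" by (rule alg1_run_None[OF run k])
  then show ?thesis using call_bound_ge[of A L] by simp
next
  case (Some x)
  have x: "x \<in> Omega P" using alg1_run_mem_Omega[OF run x0 eps _ Some] k by simp
  obtain d1 lam where "lam \<in> {lam_min A..lam_max A}" "alg1_iter A P eps d1 lam x (qs k) (xs (Suc k))"
    using alg1_run_Some[OF run k Some] by blast
  from alg1_iter_outcome[OF x this(1) eps this(2)] show ?thesis by simp
qed

text \<open>
  A step without sufficient decrease lowers \<open>ninactive\<close>, which can grow by at most \<open>n\<close> in any other
  step. Weighting the objective by \<open>(n + 1) / \<delta>\<close> makes the sum of the two drop by \<open>1\<close> in both cases.
\<close>

definition potential :: "real \<Rightarrow> real \<Rightarrow> point \<Rightarrow> real" where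
  "potential f_low \<delta> x = (f x - f_low) * (real n + 1) / \<delta> + real (ninactive P x)"

lemma potential_decreases:
  assumes "0 < \<delta>" "progress \<delta> x y"
  shows "potential f_low \<delta> y \<le> potential f_low \<delta> x - 1"
proof -
  \<comment> \<open>Used with \<open>c = \<delta>\<close> for a sufficient decrease and with
    \<open>c = 0\<close> for a move to the boundary.\<close>
  have *: "(f y - f_low) * (real n + 1) / \<delta> \<le> (f x - f_low) * (real n + 1) / \<delta> - c * (real n + 1) / \<delta>"
    if "f y \<le> f x - c" for c
  proof -
    have "(f y - f_low) * (real n + 1) / \<delta> \<le> (f x - f_low - c) * (real n + 1) / \<delta>"
      using that assms(1) by (intro divide_right_mono mult_right_mono) auto
    then show ?thesis by (simp add: diff_divide_distrib left_diff_distrib)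
  qed
  have "real (ninactive P y) \<le> real n" using ninactive_le by simp
  then show ?thesis
    using assms *[of \<delta>] *[of 0] by (auto simp: progress_def potential_def)
qed

text \<open>The potential is nonnegative on the box and drops by at least 1 in every iteration that
  does not stop, so its initial value bounds the index of the first stop.\<close>

lemma alg1_run_terminates:
  assumes run: "\<And>N. alg1_run A P eps x0 xs qs N" and x0: "x0 \<in> Omega P" and eps: "0 < eps"
    and low: "\<And>x. x \<in> Rn n \<Longrightarrow> f_low \<le> f x"
  defines "\<Phi> \<equiv> potential f_low (iter_decrease A L * eps\<^sup>2)"
  shows "\<exists>K x. xs K = Some x \<and> enorm n (red_grad P x) \<le> eps \<and> real K \<le> \<Phi> x0"
proof -
  define stopped where "stopped k \<longleftrightarrow> (\<exists>x. xs k = Some x \<and> enorm n (red_grad P x) \<le> eps)" for k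
  have \<delta>: "0 < iter_decrease A L * eps\<^sup>2" using iter_decrease_pos eps by simp
  have alive: "\<exists>x. xs k = Some x \<and> \<Phi> x \<le> \<Phi> x0 - real k" if "\<And>j. j < k \<Longrightarrow> \<not> stopped j" for k
    using that
  proof (induction k)
    case 0
    then show ?case using run[of 0] by (simp add: alg1_run_def)
  next
    case (Suc k)
    then obtain x where x: "xs k = Some x" "\<Phi> x \<le> \<Phi> x0 - real k" by auto
    have xO: "x \<in> Omega P" using alg1_run_mem_Omega[OF run[of k] x0 eps _ x(1)] by simp
    obtain d1 lam where it: "lam \<in> {lam_min A..lam_max A}" "alg1_iter A P eps d1 lam x (qs k) (xs (Suc k))"
      using alg1_run_Some[OF run[of "Suc k"] lessI x(1)] by blast
    note out = alg1_iter_outcome[OF xO it(1) eps it(2)]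
    have "\<not> enorm n (red_grad P x) \<le> eps" using Suc.prems[of k] x by (simp add: stopped_def)
    then obtain y where y: "xs (Suc k) = Some y" "progress (iter_decrease A L * eps\<^sup>2) x y"
      using out by (cases "xs (Suc k)") auto
    then show ?case using potential_decreases[OF \<delta> y(2), of f_low] x(2) by (simp add: \<Phi>_def)
  qed
  have before: "real k \<le> \<Phi> x0" if running: "\<And>j. j < k \<Longrightarrow> \<not> stopped j" for k
  proof -
    obtain x where x: "xs k = Some x" "\<Phi> x \<le> \<Phi> x0 - real k" using alive[OF running] by blast
    have "x \<in> Omega P" using alg1_run_mem_Omega[OF run[of k] x0 eps _ x(1)] by simp
    then have "0 \<le> \<Phi> x" using low[OF Omega_subset_Rn] \<delta> by (simp add: \<Phi>_def potential_def)
    then show ?thesis using x by simp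
  qed
  have "\<exists>k. stopped k"
  proof (rule ccontr)
    assume "\<nexists>k. stopped k"
    moreover obtain k where "\<Phi> x0 < real k" using reals_Archimedean2 by blast
    ultimately show False using before[of k] by auto
  qed
  then have "stopped (LEAST k. stopped k)" by (rule LeastI_ex)
  moreover have "real (LEAST k. stopped k) \<le> \<Phi> x0"
    by (rule before) (rule not_less_Least)
  ultimately show ?thesis by (auto simp: stopped_def)
qed

lemma alg1_run_total_calls_le:
  assumes run: "\<And>N. alg1_run A P eps x0 xs qs N" and x0: "x0 \<in> Omega P"
    and eps: "0 < eps" "eps \<le> 1"
    and low: "\<And>x. x \<in> Rn n \<Longrightarrow> f_low \<le> f x"
  shows "\<exists>K x. xs K = Some x \<and> enorm n (red_grad P x) \<le> eps \<and>
    real (\<Sum>k\<le>K. length (qs k))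
      \<le> 2 * call_bound A L * ((f x0 - f_low) / iter_decrease A L + 1) * real n / eps\<^sup>2"
proof -
  let ?c = "iter_decrease A L" and ?gap = "f x0 - f_low" and ?B = "call_bound A L"
  obtain K x where K: "xs K = Some x" "enorm n (red_grad P x) \<le> eps"
    "real K \<le> potential f_low (?c * eps\<^sup>2) x0"
    using alg1_run_terminates[OF run x0 eps(1) low] by blast
  have gap: "0 \<le> ?gap" using low[OF Omega_subset_Rn[OF x0]] by simp
  have B: "0 \<le> ?B" using call_bound_ge[of A L] by simp
  \<comment> \<open>Turns the \<open>n + 1\<close> of the potential into a multiple of
    \<open>n\<close>, at the price of the factor 2 in the constant.\<close>
  have n1: "real n + 1 \<le> 2 * real n" using nvars_pos by simp
  have "?gap * (real n + 1) / (?c * eps\<^sup>2) \<le> ?gap * (2 * real n) / (?c * eps\<^sup>2)"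
    using gap n1 iter_decrease_pos by (intro divide_right_mono mult_left_mono) auto
  \<comment> \<open>The part of the bound that does not scale with the gap is absorbed through
    \<open>eps \<le> 1\<close>.\<close>
  moreover have "2 * real n \<le> 2 * real n / eps\<^sup>2"
    using eps by (simp add: le_divide_eq mult_left_le power_le_one)
  moreover have "real (ninactive P x0) \<le> real n" using ninactive_le by simp
  ultimately have "real K + 1 \<le> ?gap * (2 * real n) / (?c * eps\<^sup>2) + 2 * real n / eps\<^sup>2"
    using K(3) n1 by (simp add: potential_def)
  also have "\<dots> = 2 * (?gap / ?c + 1) * real n / eps\<^sup>2"
    using iter_decrease_pos eps by (simp add: field_simps)
  finally have it: "real K + 1 \<le> 2 * (?gap / ?c + 1) * real n / eps\<^sup>2" .
  have "real (\<Sum>k\<le>K. length (qs k)) = (\<Sum>k\<le>K. real (length (qs k)))" by simp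
  also have "\<dots> \<le> (\<Sum>k\<le>K. ?B)"
    using alg1_run_calls_le[OF run[of "Suc K"] x0 eps(1)] by (intro sum_mono) auto
  also have "\<dots> = ?B * (real K + 1)" by simp
  also have "\<dots> \<le> ?B * (2 * (?gap / ?c + 1) * real n / eps\<^sup>2)"
    using it B by (rule mult_left_mono)
  also have "\<dots> = 2 * ?B * (?gap / ?c + 1) * real n / eps\<^sup>2"
    by (simp only: times_divide_eq_right mult_ac)
  finally show ?thesis using K(1,2) by blast
qed

end

text \<open>The clause on \<open>alg1_iter\<close> shows that a run which has not stopped can always
  be continued, whatever \<open>d1\<close> and \<open>lam\<close> are chosen, so the bounds on runs
  are not vacuous. The sum up to and including \<open>K\<close> also charges the gradient call of
  the iteration that stops.\<close>

theorem mainTheorem3: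
  fixes A :: alg_params and Lg gap :: real
  assumes "0 < theta A" "theta A \<le> 1"
    and "0 < rho A" "rho A < 1 / 2"
    and "1 \<le> a1 A"
    and "0 < a2 A" "a2 A < 1"
    and "0 < lam_min A" "lam_min A \<le> lam_max A"
  shows "\<exists>C::real. \<forall>(P::box_problem) (f_low::real) x0.
    0 < nvars P \<and>
    lower P \<in> Rn (nvars P) \<and> upper P \<in> Rn (nvars P) \<and>
    (\<forall>i<nvars P. lower P i < upper P i) \<and>
    C2 (nvars P) (obj P) \<and>
    (\<forall>x\<in>Rn (nvars P). \<forall>y\<in>Rn (nvars P).
       enorm (nvars P) (grad P x - grad P y) \<le> Lg * enorm (nvars P) (x - y)) \<and>
    (\<forall>x\<in>Rn (nvars P). f_low \<le> obj P x) \<and>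
    x0 \<in> Omega P \<and> obj P x0 - f_low = gap \<longrightarrow>
    (\<forall>eps>0. \<forall>xs qs N. alg1_run A P eps x0 xs qs N \<longrightarrow>
       (\<forall>k<N. real (length (qs k)) \<le>
          (real (budget A) + 5) +
          max \<bar>log 2 (min (1 / 2) ((1 - rho A) * a2 A / (2 * Lg * (a1 A)\<^sup>2)))\<bar>
              \<bar>log 2 (min 1 ((1 - 2 * rho A) * lam_min A / (4 * Lg)))\<bar>) \<and>
       (\<forall>x. xs N = Some x \<longrightarrow>
          (\<forall>d1\<in>Rn (ninactive P x). \<forall>lam\<in>{lam_min A..lam_max A}.
             \<exists>q r. alg1_iter A P eps d1 lam x q r))) \<and>
    (\<forall>eps. 0 < eps \<and> eps \<le> 1 \<longrightarrow>
       (\<forall>xs qs. (\<forall>N. alg1_run A P eps x0 xs qs N) \<longrightarrow>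
          (\<exists>K x. xs K = Some x \<and> enorm (nvars P) (red_grad P x) \<le> eps \<and>
             real (\<Sum>k\<le>K. length (qs k)) \<le> C * real (nvars P) / eps\<^sup>2)))"
\<comment> \<open>The witness is formed from \<open>A\<close>, \<open>Lg\<close> and
  \<open>gap\<close> alone and is fixed before the problem, hence before the dimension and
  \<open>eps\<close>.\<close>
proof (rule exI[where x = "2 * call_bound A Lg * (gap / iter_decrease A Lg + 1)"],
    intro allI impI, elim conjE)
  fix P :: box_problem and f_low :: real and x0 :: point
  assume n: "0 < nvars P" and lu: "\<forall>i<nvars P. lower P i < upper P i"
    and C2: "C2 (nvars P) (obj P)"
    and Lip: "\<forall>x\<in>Rn (nvars P). \<forall>y\<in>Rn (nvars P).
       enorm (nvars P) (grad P x - grad P y) \<le> Lg * enorm (nvars P) (x - y)"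
    and low: "\<forall>x\<in>Rn (nvars P). f_low \<le> obj P x"
    and x0: "x0 \<in> Omega P" and gap: "obj P x0 - f_low = gap"
  interpret box_method P Lg A
    using n lu C2 Lip assms by unfold_locales (auto simp: C2_def C1_def)
  show "(\<forall>eps>0. \<forall>xs qs N. alg1_run A P eps x0 xs qs N \<longrightarrow>
       (\<forall>k<N. real (length (qs k)) \<le>
          (real (budget A) + 5) + max (inner_log A Lg) (leave_log A Lg)) \<and>
       (\<forall>x. xs N = Some x \<longrightarrow>
          (\<forall>d1\<in>Rn (ninactive P x). \<forall>lam\<in>{lam_min A..lam_max A}.
             \<exists>q r. alg1_iter A P eps d1 lam x q r))) \<and>
    (\<forall>eps. 0 < eps \<and> eps \<le> 1 \<longrightarrow>
       (\<forall>xs qs. (\<forall>N. alg1_run A P eps x0 xs qs N) \<longrightarrow>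
          (\<exists>K x. xs K = Some x \<and> enorm (nvars P) (red_grad P x) \<le> eps \<and>
             real (\<Sum>k\<le>K. length (qs k))
               \<le> 2 * call_bound A Lg * (gap / iter_decrease A Lg + 1) * real (nvars P) / eps\<^sup>2)))"
  proof (intro conjI allI impI ballI)
    fix eps :: real and xs qs N k
    assume "0 < eps" "alg1_run A P eps x0 xs qs N" "k < N"
    then show "real (length (qs k)) \<le> (real (budget A) + 5) + max (inner_log A Lg) (leave_log A Lg)"
      using alg1_run_calls_le x0 by (simp only: call_bound_def)
  next
    fix eps :: real and xs qs N x d1 lam
    assume "0 < eps" "alg1_run A P eps x0 xs qs N" "xs N = Some x" "lam \<in> {lam_min A..lam_max A}"
    then show "\<exists>q r. alg1_iter A P eps d1 lam x q r"
      using alg1_run_mem_Omega[OF _ x0, of eps xs qs N N x] by (intro alg1_iter_exists) auto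
  next
    fix eps :: real and xs qs
    assume "0 < eps \<and> eps \<le> 1" "\<forall>N. alg1_run A P eps x0 xs qs N"
    then show "\<exists>K x. xs K = Some x \<and> enorm (nvars P) (red_grad P x) \<le> eps \<and>
             real (\<Sum>k\<le>K. length (qs k))
               \<le> 2 * call_bound A Lg * (gap / iter_decrease A Lg + 1) * real (nvars P) / eps\<^sup>2"
      using alg1_run_total_calls_le[OF _ x0, of eps xs qs f_low] low unfolding gap by blast
  qed
qed

end
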